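(* Let $\mathfrak{A}$ be a unital C*-algebra, let $E$ and $F$ be Hilbert $\mathfrak{A}$-modules with $E$ full, and let $\Psi:E\to F$ be a bijective $\mathfrak{A}$-linear mapping (not assumed bounded) which is orthogonality preserving. Let $\mathcal{F}:=((V_n,\omega_n))_{n\in\mathbb{N}^*}$ be a *-fusion frame of $E$ of bounds $A,B\in\mathfrak{A}$. Then: 1. $(\Psi(V_n))_{n\in\mathbb{N}^*}$ is a sequence of orthogonally complemented submodules of $F$, and for every $n\in\mathbb{N}^*$ $$P_{\Psi(V_n)}=\Psi P_{V_n}\Psi^{-1}.$$ 2. $((\Psi(V_n),\omega_n))_{n\in\mathbb{N}^*}$ is a *-fusion frame of $F$.
   Context: $\mathbb{N}^*=\{1,2,3,\dots\}$. Hilbert $\mathfrak{A}$-modules are left modules with $\mathfrak{A}$-valued inner product $\langle\cdot,\cdot\rangle$ that is $\mathfrak{A}$-linear in the first variable; for $x$ in such a module $\mathfrak{H}$, $|x|:=\langle x,x\rangle^{1/2}\in\mathfrak{A}$ and $\|x\|_{\mathfrak{H}}:=\||x|\|_{\mathfrak{A}}$. For $a,b\in\mathfrak{A}$, $a\preccurlyeq b$ means that $b-a$ is positive. An element of $\mathfrak{A}$ is strictly positive if every nonzero positive linear form takes a value $>0$ on it; since $\mathfrak{A}$ is unital this is equivalent to being positive and invertible. A closed submodule $\mathfrak{K}$ of a Hilbert $\mathfrak{A}$-module $\mathfrak{H}$ is orthogonally complemented if $\mathfrak{H}=\mathfrak{K}\oplus\mathfrak{K}^\perp$, where $\mathfrak{K}^\perp=\{u\in\mathfrak{H}:\langle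 u,x\rangle=0\ \forall x\in\mathfrak{K}\}$; $P_{\mathfrak{K}}$ denotes the corresponding orthogonal projection of $\mathfrak{H}$ onto $\mathfrak{K}$. A weight of $\mathfrak{A}$ is a sequence $(\omega_n)_{n\in\mathbb{N}^*}$ of central and strictly positive elements of $\mathfrak{A}$. Given a sequence $(\mathfrak{H}_n)_{n\in\mathbb{N}^*}$ of orthogonally complemented submodules of $\mathfrak{H}$ and a weight $(\omega_n)_{n\in\mathbb{N}^*}$ of $\mathfrak{A}$, the sequence $((\mathfrak{H}_n,\omega_n))_{n\in\mathbb{N}^*}$ is a *-fusion frame of $\mathfrak{H}$ if for each $x\in\mathfrak{H}$ the series $\sum\omega_n^2|P_{\mathfrak{H}_n}(x)|^2$ converges in the norm of $\mathfrak{A}$ and there exist two strictly positive elements $A,B$ of $\mathfrak{A}$ such that $|Ax|^2\preccurlyeq\sum_{n=1}^{+\infty}\omega_n^2|P_{\mathfrak{H}_n}(x)|^2\preccurlyeq|Bx|^2$ for all $x\in\mathfrak{H}$; $A$ and $B$ are called lower and upper bounds. A Hilbert $\mathfrak{A}$-module $E$ is full if the ideal of $\mathfrak{A}$ generated by $\{\langle x,y\rangle:x,y\in E\}$ is $\mathfrak{A}$. An $\mathfrak{A}$-linear mapping $\Psi:E\to F$ is orthogonality preserving if, for all $x,y\in E$, $\langle x,y\rangle=0$ implies $\langle\Psi(x),\Psi(y)\rangle=0$. *)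

theory Defs
  imports Complex_Main
begin

section \<open>Unital C*-algebras\<close>

text \<open>
  The underlying real Banach algebra comes from the library classes. They entail \<open>0 \<noteq> 1\<close>, so the
  zero algebra is not covered; \<open>norm 1 = 1\<close> is then automatic in a C*-algebra.
\<close>

class cstar_algebra_1 = real_normed_algebra_1 + banach +
  fixes scaleC :: "complex \<Rightarrow> 'a \<Rightarrow> 'a"  (infixr \<open>*\<^sub>C\<close> 75)
    and star :: "'a \<Rightarrow> 'a"
  assumes scaleC_add_right: "c *\<^sub>C (a + b) = c *\<^sub>C a + c *\<^sub>C b"
    and scaleC_add_left: "(c + d) *\<^sub>C a = c *\<^sub>C a + d *\<^sub>C a"
    and scaleC_scaleC: "c *\<^sub>C (d *\<^sub>C a) = (c * d) *\<^sub>C a"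
    and scaleR_scaleC: "r *\<^sub>R a = complex_of_real r *\<^sub>C a"
    and mult_scaleC_left: "(c *\<^sub>C a) * b = c *\<^sub>C (a * b)"
    and mult_scaleC_right: "a * (c *\<^sub>C b) = c *\<^sub>C (a * b)"
    and norm_scaleC: "norm (c *\<^sub>C a) = cmod c * norm a"
    and star_add: "star (a + b) = star a + star b"
    and star_scaleC: "star (c *\<^sub>C a) = cnj c *\<^sub>C star a"
    and star_mult: "star (a * b) = star b * star a"
    and star_star: "star (star a) = a"
    and norm_star_mult_self: "norm (star a * a) = (norm a)\<^sup>2"

definition cstar_positive :: "'a::cstar_algebra_1 \<Rightarrow> bool" where
  "cstar_positive a \<longleftrightarrow> (\<exists>b. a = star b * b)"

definition cstar_le :: "'a::cstar_algebra_1 \<Rightarrow> 'a \<Rightarrow> bool"  (infix \<open>\<preceq>\<close> 50) where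
  "a \<preceq> b \<longleftrightarrow> cstar_positive (b - a)"

text \<open>
  A positive element of a C*-algebra has exactly one positive square root; on other elements the
  value below is unspecified.
\<close>

definition cstar_sqrt :: "'a::cstar_algebra_1 \<Rightarrow> 'a" where
  "cstar_sqrt a = (THE b. cstar_positive b \<and> b * b = a)"

definition positive_linear_form :: "('a::cstar_algebra_1 \<Rightarrow> complex) \<Rightarrow> bool" where
  "positive_linear_form f \<longleftrightarrow>
     (\<forall>a b. f (a + b) = f a + f b) \<and>
     (\<forall>c a. f (c *\<^sub>C a) = c * f a) \<and>
     (\<forall>a. cstar_positive a \<longrightarrow> f a \<in> \<real> \<and> 0 \<le> Re (f a))"

definition strictly_positive :: "'a::cstar_algebra_1 \<Rightarrow> bool" where
  "strictly_positive a \<longleftrightarrow>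
     (\<forall>f. positive_linear_form f \<and> (\<exists>b. f b \<noteq> 0) \<longrightarrow> f a \<in> \<real> \<and> 0 < Re (f a))"

definition central :: "'a::cstar_algebra_1 \<Rightarrow> bool" where
  "central a \<longleftrightarrow> (\<forall>b. a * b = b * a)"

definition two_sided_ideal :: "'a::cstar_algebra_1 set \<Rightarrow> bool" where
  "two_sided_ideal I \<longleftrightarrow>
     0 \<in> I \<and> (\<forall>a\<in>I. \<forall>b\<in>I. a + b \<in> I) \<and> (\<forall>a\<in>I. \<forall>b. b * a \<in> I \<and> a * b \<in> I)"


section \<open>Hilbert modules\<close>

text \<open>
  A left module over the algebra \<open>'a\<close> is given by its action \<open>sm\<close> and its inner product \<open>ip\<close>;
  the complex scalar \<open>c\<close> acts as \<open>sm (c *\<^sub>C 1)\<close>.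
\<close>

definition module_abs :: "('e \<Rightarrow> 'e \<Rightarrow> 'a::cstar_algebra_1) \<Rightarrow> 'e \<Rightarrow> 'a" where
  "module_abs ip x = cstar_sqrt (ip x x)"

text \<open>
  Completeness is the \<open>banach\<close> sort of \<open>'e\<close>, whose norm is tied to the inner product by
  \<open>norm_eq\<close>.
\<close>

locale hilbert_module =
  fixes sm :: "'a::cstar_algebra_1 \<Rightarrow> 'e::banach \<Rightarrow> 'e"
    and ip :: "'e \<Rightarrow> 'e \<Rightarrow> 'a"
  assumes sm_add_right: "sm a (x + y) = sm a x + sm a y"
    and sm_add_left: "sm (a + b) x = sm a x + sm b x"
    and sm_mult: "sm (a * b) x = sm a (sm b x)"
    and sm_one: "sm 1 x = x"
    and sm_scaleR: "sm (r *\<^sub>R 1) x = r *\<^sub>R x"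
    and ip_add_left: "ip (x + y) z = ip x z + ip y z"
    and ip_sm_left: "ip (sm a x) y = a * ip x y"
    and ip_star: "star (ip x y) = ip y x"
    and ip_positive: "cstar_positive (ip x x)"
    and ip_definite: "ip x x = 0 \<Longrightarrow> x = 0"
    and norm_eq: "norm x = norm (module_abs ip x)"

definition full_module :: "('e \<Rightarrow> 'e \<Rightarrow> 'a::cstar_algebra_1) \<Rightarrow> bool" where
  "full_module ip \<longleftrightarrow> two_sided_ideal hull {ip x y |x y. True} = UNIV"

definition submodule ::
  "('a::cstar_algebra_1 \<Rightarrow> 'e::banach \<Rightarrow> 'e) \<Rightarrow> 'e set \<Rightarrow> bool" where
  "submodule sm K \<longleftrightarrow>
     0 \<in> K \<and> (\<forall>x\<in>K. \<forall>y\<in>K. x + y \<in> K) \<and> (\<forall>a. \<forall>x\<in>K. sm a x \<in> K)"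

definition orthogonal :: "('e \<Rightarrow> 'e \<Rightarrow> 'a::cstar_algebra_1) \<Rightarrow> 'e set \<Rightarrow> 'e set" where
  "orthogonal ip K = {u. \<forall>x\<in>K. ip u x = 0}"

definition orthogonally_complemented ::
  "('a::cstar_algebra_1 \<Rightarrow> 'e::banach \<Rightarrow> 'e) \<Rightarrow> ('e \<Rightarrow> 'e \<Rightarrow> 'a) \<Rightarrow> 'e set \<Rightarrow> bool" where
  "orthogonally_complemented sm ip K \<longleftrightarrow>
     submodule sm K \<and> closed K \<and>
     (\<forall>x. \<exists>k\<in>K. \<exists>u\<in>orthogonal ip K. x = k + u) \<and> K \<inter> orthogonal ip K = {0}"

definition orth_proj ::
  "('e::banach \<Rightarrow> 'e \<Rightarrow> 'a::cstar_algebra_1) \<Rightarrow> 'e set \<Rightarrow> 'e \<Rightarrow> 'e" where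
  "orth_proj ip K x = (THE k. k \<in> K \<and> x - k \<in> orthogonal ip K)"

definition module_linear ::
  "('a \<Rightarrow> 'e \<Rightarrow> 'e) \<Rightarrow> ('a \<Rightarrow> 'f \<Rightarrow> 'f)
     \<Rightarrow> ('e::banach \<Rightarrow> 'f::banach) \<Rightarrow> bool" where
  "module_linear smE smF \<Psi> \<longleftrightarrow>
     (\<forall>x y. \<Psi> (x + y) = \<Psi> x + \<Psi> y) \<and> (\<forall>a x. \<Psi> (smE a x) = smF a (\<Psi> x))"

definition orthogonality_preserving ::
  "('e \<Rightarrow> 'e \<Rightarrow> 'a::cstar_algebra_1) \<Rightarrow> ('f \<Rightarrow> 'f \<Rightarrow> 'a) \<Rightarrow> ('e \<Rightarrow> 'f) \<Rightarrow> bool" where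
  "orthogonality_preserving ipE ipF \<Psi> \<longleftrightarrow> (\<forall>x y. ipE x y = 0 \<longrightarrow> ipF (\<Psi> x) (\<Psi> y) = 0)"


section \<open>*-fusion frames\<close>

text \<open>
  Sequences are indexed by the positive integers: the value at \<open>0\<close> is never used, and series run
  over \<open>Suc n\<close>.
\<close>

definition weight :: "(nat \<Rightarrow> 'a::cstar_algebra_1) \<Rightarrow> bool" where
  "weight \<omega> \<longleftrightarrow> (\<forall>n\<ge>1. central (\<omega> n) \<and> strictly_positive (\<omega> n))"

definition frame_term ::
  "('e::banach \<Rightarrow> 'e \<Rightarrow> 'a::cstar_algebra_1) \<Rightarrow> (nat \<Rightarrow> 'e set) \<Rightarrow> (nat \<Rightarrow> 'a) \<Rightarrow> 'e \<Rightarrow> nat \<Rightarrow> 'a"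
  where "frame_term ip V \<omega> x n = (\<omega> n)\<^sup>2 * (module_abs ip (orth_proj ip (V n) x))\<^sup>2"

definition star_fusion_frame_bounds ::
  "('a::cstar_algebra_1 \<Rightarrow> 'e::banach \<Rightarrow> 'e) \<Rightarrow> ('e \<Rightarrow> 'e \<Rightarrow> 'a)
     \<Rightarrow> (nat \<Rightarrow> 'e set) \<Rightarrow> (nat \<Rightarrow> 'a) \<Rightarrow> 'a \<Rightarrow> 'a \<Rightarrow> bool" where
  "star_fusion_frame_bounds sm ip V \<omega> A B \<longleftrightarrow>
     (\<forall>n\<ge>1. orthogonally_complemented sm ip (V n)) \<and> weight \<omega> \<and>
     (\<forall>x. summable (\<lambda>n. frame_term ip V \<omega> x (Suc n))) \<and>
     strictly_positive A \<and> strictly_positive B \<and>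
     (\<forall>x. (module_abs ip (sm A x))\<^sup>2 \<preceq> (\<Sum>n. frame_term ip V \<omega> x (Suc n)) \<and>
          (\<Sum>n. frame_term ip V \<omega> x (Suc n)) \<preceq> (module_abs ip (sm B x))\<^sup>2)"

definition star_fusion_frame ::
  "('a::cstar_algebra_1 \<Rightarrow> 'e::banach \<Rightarrow> 'e) \<Rightarrow> ('e \<Rightarrow> 'e \<Rightarrow> 'a)
     \<Rightarrow> (nat \<Rightarrow> 'e set) \<Rightarrow> (nat \<Rightarrow> 'a) \<Rightarrow> bool" where
  "star_fusion_frame sm ip V \<omega> \<longleftrightarrow> (\<exists>A B. star_fusion_frame_bounds sm ip V \<omega> A B)"

end

(*
  Put D(x,y) = <Psi x, Psi y>, and let p = <y,y>, delta = D(y,y). For selfadjoint a, b commuting with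
  p and with a b = 0, the vectors a y and b y are orthogonal, so a delta b = 0; a bisection argument
  then shows that delta commutes with everything selfadjoint that commutes with p. Subtracting from
  w a multiple of y makes it orthogonal to the part of y over a spectral interval of p away from 0,
  which gives p D(y,w) = delta <y,w>, and by approximation and polarization
  <x,y> D(z,w) = D(x,y) <z,w>. Since E is full, D = u <.,.> for a central positive u, so multiplying
  the frame inequalities of E by u gives those of F, with the same bounds A and B. The image of V is
  closed because it is the orthogonal complement of the image of the complement of V.
*)

theory Submission
  imports Defs
begin

text \<open>\<open>\<Psi>\<close> is not assumed bounded, so \<open>D\<close> cannot be treated as
  continuous: every approximation has to take place in the coefficients, with values such as
  \<open>D y w\<close> and \<open>D x y\<close> held fixed. Nor can one divide by \<open>p\<close>,
  which may be singular, and the algebra need not contain spectral projections. Their place is taken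
  by the positive and negative parts of \<open>e - p\<close> and by the inverse of
  \<open>p + e\<close>, all of which commute with whatever commutes with \<open>p\<close>. These
  rest in turn on a square root obtained by iteration; the order theory, up to positivity of
  \<open>star b * b\<close>, is then algebra together with the C*-identity.\<close>

section \<open>The involution and the C*-identity\<close>

lemma star_zero [simp]: "star (0::'a::cstar_algebra_1) = 0"
  using star_add[of "0::'a" 0] by simp

lemma star_one [simp]: "star (1::'a::cstar_algebra_1) = 1"
  by (metis mult.left_neutral mult.right_neutral star_mult star_star)

lemma star_scaleR: "star (r *\<^sub>R a) = r *\<^sub>R star (a::'a::cstar_algebra_1)"
  by (simp add: scaleR_scaleC star_scaleC)

lemma star_minus: "star (- a) = - star (a::'a::cstar_algebra_1)"
  using star_scaleR[of "-1" a] by simp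

lemma star_diff: "star (a - b) = star a - star (b::'a::cstar_algebra_1)"
  by (metis star_add star_minus uminus_add_conv_diff add.commute)

lemmas star_simps = star_add star_diff star_minus star_scaleR star_mult star_star

lemma norm_star: "norm (star a) = norm (a::'a::cstar_algebra_1)"
proof -
  have le: "norm b \<le> norm (star b)" for b :: 'a
  proof (cases "b = 0")
    case False
    have "norm b * norm b \<le> norm (star b) * norm b"
      using norm_star_mult_self[of b] norm_mult_ineq[of "star b" b] by (simp add: power2_eq_square)
    then show ?thesis using False by simp
  qed simp
  from le[of a] le[of "star a"] show ?thesis by (simp add: star_star)
qed

lemma norm_mult_star_self: "norm (a * star a) = (norm (a::'a::cstar_algebra_1))\<^sup>2"
  using norm_star_mult_self[of "star a"] by (simp add: star_star norm_star)

lemma tendsto_star: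
  assumes "(f \<longlongrightarrow> (a::'a::cstar_algebra_1)) F"
  shows "((\<lambda>x. star (f x)) \<longlongrightarrow> star a) F"
proof -
  have "bounded_linear (star :: 'a \<Rightarrow> 'a)"
    by (rule bounded_linear_intro[where K = 1]) (auto simp: star_simps norm_star)
  from bounded_linear.tendsto[OF this assms] show ?thesis .
qed

lemma norm_selfadjoint_square:
  "star a = a \<Longrightarrow> norm (a * a) = (norm (a::'a::cstar_algebra_1))\<^sup>2"
  using norm_star_mult_self[of a] by simp

lemma selfadjoint_square_zero:
  "star a = a \<Longrightarrow> a * a = 0 \<Longrightarrow> a = (0::'a::cstar_algebra_1)"
  using norm_selfadjoint_square[of a] by simp

lemma selfadjoint_cube_zero:
  assumes "star a = a" "a * a * a = (0::'a::cstar_algebra_1)"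
  shows "a = 0"
proof (rule selfadjoint_square_zero[OF assms(1)], rule selfadjoint_square_zero)
  show "star (a * a) = a * a" by (simp add: star_mult assms)
  show "a * a * (a * a) = 0" using assms(2) by (simp add: mult.assoc[symmetric])
qed

lemma scaleC_minus_right: "c *\<^sub>C (- a) = - (c *\<^sub>C (a::'a::cstar_algebra_1))"
proof -
  have "c *\<^sub>C 0 = (0::'a)" using scaleC_add_right[of c "0::'a" 0] by simp
  then show ?thesis using scaleC_add_right[of c a "- a"] by (simp add: minus_unique)
qed

lemma scaleC_diff_right: "c *\<^sub>C (a - b) = c *\<^sub>C a - c *\<^sub>C (b::'a::cstar_algebra_1)"
  using scaleC_add_right[of c a "- b"] by (simp add: scaleC_minus_right)

lemma scaleC_minus_one: "(-1) *\<^sub>C a = - (a::'a::cstar_algebra_1)"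
  using scaleR_scaleC[of "-1" a] by simp

lemma scaleC_i_i: "\<i> *\<^sub>C (\<i> *\<^sub>C a) = - (a::'a::cstar_algebra_1)"
  by (simp add: scaleC_scaleC scaleC_minus_one)

lemma star_scaleC_i: "star (\<i> *\<^sub>C a) = - (\<i> *\<^sub>C star (a::'a::cstar_algebra_1))"
proof -
  have "star (\<i> *\<^sub>C a) = ((-1) * \<i>) *\<^sub>C star a" by (simp add: star_scaleC)
  also have "\<dots> = - (\<i> *\<^sub>C star a)" by (simp only: scaleC_scaleC[symmetric] scaleC_minus_one)
  finally show ?thesis .
qed


section \<open>Positive elements\<close>

text \<open>
  Visser's iteration \<open>y \<mapsto> (x + y\<^sup>2) / 2\<close>; its increments are dominated by those of the same
  iteration run on the number \<open>1\<close>.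
\<close>

lemma sqrt_one_minus_exists:
  fixes x :: "'a::cstar_algebra_1"
  assumes sa: "star x = x" and n: "norm x \<le> 1"
  obtains y where "star y = y" "norm y \<le> 1" "(1 - y) * (1 - y) = 1 - x"
    "\<And>c. c * x = x * c \<Longrightarrow> c * y = y * c"
proof -
  define Y where "Y = rec_nat (0::'a) (\<lambda>_ y. (1/2) *\<^sub>R (x + y * y))"
  define R where "R = rec_nat (0::real) (\<lambda>_ y. (1 + y * y) / 2)"
  have Y0: "Y 0 = 0" and YS: "Y (Suc k) = (1/2) *\<^sub>R (x + Y k * Y k)" for k
    by (simp_all add: Y_def)
  have R0: "R 0 = 0" and RS: "R (Suc k) = (1 + R k * R k) / 2" for k
    by (simp_all add: R_def)
  have R: "0 \<le> R k \<and> R k \<le> 1" for k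
  proof (induction k)
    case (Suc k)
    then have "R k * R k \<le> 1 * 1" by (intro mult_mono) auto
    with Suc show ?case by (simp add: RS)
  qed (simp add: R0)
  \<comment> \<open>Every iterate is a polynomial in \<open>x\<close>; in particular the iterates
    commute with one another.\<close>
  have Yc: "c * Y k = Y k * c" if "c * x = x * c" for c k
  proof (induction k)
    case (Suc k)
    have "c * (Y k * Y k) = Y k * Y k * c" using Suc by (metis mult.assoc)
    then show ?case using that by (simp add: YS algebra_simps)
  qed (simp add: Y0)
  have YY: "Y j * Y k = Y k * Y j" for j k by (intro Yc[symmetric] Yc) simp
  have Ys: "star (Y k) = Y k" for k
    by (induction k) (simp_all add: Y0 YS star_simps sa)
  have Yn: "norm (Y k) \<le> R k" for k
  proof (induction k)
    case (Suc k)
    have "norm (Y k * Y k) \<le> R k * R k"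
      by (rule order_trans[OF norm_mult_ineq]) (use Suc R in \<open>auto intro: mult_mono\<close>)
    then have "norm (x + Y k * Y k) \<le> 1 + R k * R k"
      using n norm_triangle_ineq[of x "Y k * Y k"] by linarith
    then show ?case by (simp add: YS RS)
  qed (simp add: Y0 R0)
  have inc: "norm (Y (Suc k) - Y k) \<le> R (Suc k) - R k" for k
  proof (induction k)
    case 0
    show ?case using n by (simp add: YS RS Y0 R0)
  next
    case (Suc k)
    have "Y (Suc (Suc k)) - Y (Suc k)
        = (1/2) *\<^sub>R (Y (Suc k) * Y (Suc k) - Y k * Y k)"
      by (subst YS, subst (3) YS) (simp add: algebra_simps)
    also have "Y (Suc k) * Y (Suc k) - Y k * Y k = (Y (Suc k) - Y k) * (Y (Suc k) + Y k)"
      using YY[of k "Suc k"] by (simp add: algebra_simps)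
    finally have "norm (Y (Suc (Suc k)) - Y (Suc k))
        = (1/2) * norm ((Y (Suc k) - Y k) * (Y (Suc k) + Y k))" by simp
    also have "\<dots> \<le> (1/2) * ((R (Suc k) - R k) * (R (Suc k) + R k))"
    proof -
      have "norm (Y (Suc k) + Y k) \<le> R (Suc k) + R k"
        using norm_triangle_ineq[of "Y (Suc k)" "Y k"] Yn[of "Suc k"] Yn[of k] by linarith
      then have "norm (Y (Suc k) - Y k) * norm (Y (Suc k) + Y k)
          \<le> (R (Suc k) - R k) * (R (Suc k) + R k)"
        using Suc order_trans[OF norm_ge_zero Suc] by (intro mult_mono) auto
      then show ?thesis using norm_mult_ineq[of "Y (Suc k) - Y k" "Y (Suc k) + Y k"] by linarith
    qed
    also have "\<dots> = R (Suc (Suc k)) - R (Suc k)"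
    proof -
      have "(1/2) * ((a - b) * (a + b)) = (1 + a * a) / 2 - (1 + b * b) / 2" for a b :: real
        by (simp add: field_simps)
      from this[of "R (Suc k)" "R k"] show ?thesis by (simp only: RS[symmetric])
    qed
    finally show ?case .
  qed
  have "incseq R"
  proof (rule incseq_SucI)
    show "R k \<le> R (Suc k)" for k using inc[of k] norm_ge_zero[of "Y (Suc k) - Y k"] by linarith
  qed
  moreover have "Bseq R" using R by (intro BseqI'[where K = 1]) auto
  ultimately have "convergent R" by (intro Bseq_monoseq_convergent) (auto simp: monoseq_iff)
  then obtain L where "R \<longlonglongrightarrow> L" by (auto simp: convergent_def)
  then have "(\<lambda>k. R (Suc k) - R k) sums (L - R 0)"
    by (rule telescope_sums)
  then have "summable (\<lambda>k. R (Suc k) - R k)" by (rule sums_summable)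
  then have "summable (\<lambda>k. Y (Suc k) - Y k)"
    by (rule summable_comparison_test[rotated]) (use inc in auto)
  then obtain l where "(\<lambda>k. Y (Suc k) - Y k) sums l" by (auto simp: summable_def)
  then have "Y \<longlonglongrightarrow> l"
    by (simp add: sums_def sum_lessThan_telescope Y0)
  then have lim: "Y \<longlonglongrightarrow> l" "(\<lambda>k. Y (Suc k)) \<longlonglongrightarrow> l" by (auto simp: LIMSEQ_Suc)
  have "star l = l"
    using tendsto_star[OF lim(1)] lim(1) unfolding Ys by (rule LIMSEQ_unique)
  moreover have "norm l \<le> 1"
  proof (rule LIMSEQ_le_const2[OF tendsto_norm[OF lim(1)]])
    show "\<exists>N. \<forall>k\<ge>N. norm (Y k) \<le> 1"
      using order_trans[OF Yn conjunct2[OF R]] by blast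
  qed
  \<comment> \<open>The fixed point equation \<open>2 l = x + l * l\<close> is the claimed identity
    after completing the square.\<close>
  moreover have "(1 - l) * (1 - l) = 1 - x"
  proof -
    have "(\<lambda>k. Y (Suc k)) \<longlonglongrightarrow> (1/2) *\<^sub>R (x + l * l)"
      unfolding YS by (intro tendsto_intros lim)
    then have "l = (1/2) *\<^sub>R (x + l * l)" using lim(2) LIMSEQ_unique by blast
    then have "l + l = x + l * l" by (metis scaleR_half_double scaleR_add_right)
    then show ?thesis by (simp add: algebra_simps)
  qed
  moreover have "c * l = l * c" if "c * x = x * c" for c
  proof (rule LIMSEQ_unique)
    show "(\<lambda>k. c * Y k) \<longlonglongrightarrow> c * l" by (intro tendsto_intros lim)
    show "(\<lambda>k. c * Y k) \<longlonglongrightarrow> l * c"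
      unfolding Yc[OF that] by (intro tendsto_intros lim)
  qed
  ultimately show ?thesis by (rule that)
qed

text \<open>Here \<open>s + \<i> r\<close> is a multiple of a unitary.\<close>

lemma norm_square_le_of_sum_squares:
  fixes s r :: "'a::cstar_algebra_1"
  assumes sa: "star s = s" "star r = r" and comm: "s * r = r * s"
    and sum: "s * s + r * r = t *\<^sub>R 1" and t: "0 \<le> t"
  shows "norm (s * s) \<le> t"
proof -
  define u where "u = s + \<i> *\<^sub>C r"
  have su: "star u = s - \<i> *\<^sub>C r" by (simp add: u_def star_add star_scaleC_i sa)
  have "star u * u = t *\<^sub>R 1"
    unfolding su unfolding u_def
    using comm sum by (simp add: algebra_simps mult_scaleC_left mult_scaleC_right scaleC_i_i
        scaleC_add_right scaleC_diff_right)
  then have "(norm u)\<^sup>2 = t" using norm_star_mult_self[of u] t by simp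
  moreover have "2 *\<^sub>R s = u + star u" unfolding su unfolding u_def by (simp add: scaleR_2)
  then have "norm (2 *\<^sub>R s) \<le> norm u + norm u"
    using norm_triangle_ineq[of u "star u"] by (simp only: norm_star)
  then have "norm s \<le> norm u" by simp
  ultimately show ?thesis
    using power_mono[of "norm s" "norm u" 2] by (simp add: norm_selfadjoint_square sa)
qed

text \<open>If \<open>1 - y\<close> is a root of \<open>1 - s * s\<close>, then the squares of
  \<open>1 - y\<close> and \<open>s\<close> add up to \<open>1\<close>, so the first of them has
  norm at most \<open>1\<close>.\<close>

lemma norm_one_minus_square_le:
  fixes s :: "'a::cstar_algebra_1"
  assumes sa: "star s = s" and n: "norm s \<le> 1"
  shows "norm (1 - s * s) \<le> 1"
proof -
  have "norm (s * s) \<le> 1"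
    using n power_mono[of "norm s" 1 2] by (simp add: norm_selfadjoint_square sa)
  then obtain y where y: "star y = y" "(1 - y) * (1 - y) = 1 - s * s"
      "\<And>c. c * (s * s) = s * s * c \<Longrightarrow> c * y = y * c"
    using sqrt_one_minus_exists[of "s * s"] by (metis sa star_mult)
  have "s * y = y * s" by (rule y(3)) (simp add: mult.assoc)
  then have "norm ((1 - y) * (1 - y)) \<le> 1"
  proof (intro norm_square_le_of_sum_squares[where r = s])
    show "(1 - y) * (1 - y) + s * s = 1 *\<^sub>R 1" using y(2) by simp
  qed (simp_all add: y(1) star_diff sa algebra_simps)
  then show ?thesis by (simp add: y)
qed

section \<open>The cone of selfadjoint squares\<close>

text \<open>The working notion of positivity. That every \<open>star b * b\<close> has this form is
  a theorem, reached only after sums and commuting products of such elements are under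
  control.\<close>

definition selfadjoint_square :: "'a::cstar_algebra_1 \<Rightarrow> bool" where
  "selfadjoint_square a \<longleftrightarrow> (\<exists>s. star s = s \<and> a = s * s)"

lemma selfadjoint_square_star: "selfadjoint_square a \<Longrightarrow> star a = a"
  by (auto simp: selfadjoint_square_def star_mult)

lemma selfadjoint_square_norm:
  assumes "selfadjoint_square a"
  obtains t where "0 < t" "norm (t *\<^sub>R 1 - a) \<le> t"
proof -
  obtain s where s: "star s = s" "a = s * s" using assms by (auto simp: selfadjoint_square_def)
  \<comment> \<open>The added \<open>1\<close> keeps \<open>k\<close> positive when
    \<open>s = 0\<close>; dividing by \<open>k\<close> brings \<open>s\<close> into the unit
    ball.\<close>
  define k where "k = norm s + 1"
  have k: "0 < k" "norm s \<le> k" by (simp_all add: k_def add_nonneg_pos)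
  have "norm (1 - ((1/k) *\<^sub>R s) * ((1/k) *\<^sub>R s)) \<le> 1"
    by (rule norm_one_minus_square_le) (use k in \<open>simp_all add: star_scaleR s\<close>)
  moreover have "k\<^sup>2 *\<^sub>R 1 - a = k\<^sup>2 *\<^sub>R (1 - ((1/k) *\<^sub>R s) * ((1/k) *\<^sub>R s))"
    using k by (simp add: s scaleR_diff_right power2_eq_square)
  ultimately have "norm (k\<^sup>2 *\<^sub>R 1 - a) \<le> k\<^sup>2"
    by (simp add: mult_left_le)
  then show ?thesis using that[of "k\<^sup>2"] k by simp
qed

text \<open>Rescaling writes \<open>a\<close> as \<open>t\<close> times \<open>1 - x\<close> with
  \<open>x\<close> in the unit ball. The norm estimate on \<open>s\<close> is the same criterion
  again, and will show that the root is itself positive.\<close>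

lemma selfadjoint_root_exists:
  fixes a :: "'a::cstar_algebra_1"
  assumes sa: "star a = a" and t: "0 < t" "norm (t *\<^sub>R 1 - a) \<le> t"
  obtains s where "star s = s" "s * s = a" "\<And>c. c * a = a * c \<Longrightarrow> c * s = s * c"
    "norm (sqrt t *\<^sub>R 1 - s) \<le> sqrt t"
proof -
  define x where "x = 1 - (1/t) *\<^sub>R a"
  have tx: "t *\<^sub>R x = t *\<^sub>R 1 - a" using t by (simp add: x_def scaleR_diff_right)
  have "t * norm x \<le> t" using t tx by (metis abs_of_pos norm_scaleR)
  then have "norm x \<le> 1" using t by simp
  then obtain y where y: "star y = y" "norm y \<le> 1" "(1 - y) * (1 - y) = 1 - x"
      "\<And>c. c * x = x * c \<Longrightarrow> c * y = y * c"
    using sqrt_one_minus_exists[of x] sa by (auto simp: x_def star_simps)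
  define s where "s = sqrt t *\<^sub>R (1 - y)"
  show ?thesis
  proof
    show "star s = s" by (simp add: s_def star_simps y)
    have "s * s = t *\<^sub>R ((1 - y) * (1 - y))" using t by (simp add: s_def)
    then show "s * s = a" using t by (simp add: y(3) x_def)
    show "c * s = s * c" if "c * a = a * c" for c
    proof -
      have "c * x = x * c" using that by (simp add: x_def algebra_simps)
      then show ?thesis by (simp add: s_def algebra_simps y(4))
    qed
    have "sqrt t *\<^sub>R 1 - s = sqrt t *\<^sub>R y" by (simp add: s_def scaleR_diff_right)
    then show "norm (sqrt t *\<^sub>R 1 - s) \<le> sqrt t" using y(2) t by (simp add: mult_left_le)
  qed
qed

text \<open>A norm form of "the spectrum lies in \<open>[0, 2t]\<close>". It makes closure under
  sums a matter of the triangle inequality.\<close>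

lemma selfadjoint_square_iff_norm:
  "selfadjoint_square a \<longleftrightarrow> star a = a \<and> (\<exists>t>0. norm (t *\<^sub>R 1 - a) \<le> t)"
proof
  assume "selfadjoint_square a"
  then show "star a = a \<and> (\<exists>t>0. norm (t *\<^sub>R 1 - a) \<le> t)"
    by (meson selfadjoint_square_norm selfadjoint_square_star)
next
  assume "star a = a \<and> (\<exists>t>0. norm (t *\<^sub>R 1 - a) \<le> t)"
  then show "selfadjoint_square a"
    unfolding selfadjoint_square_def by (metis selfadjoint_root_exists)
qed

lemma selfadjoint_square_root:
  assumes "selfadjoint_square a"
  obtains s where "selfadjoint_square s" "s * s = a" "\<And>c. c * a = a * c \<Longrightarrow> c * s = s * c"
proof -
  obtain t where t: "0 < t" "norm (t *\<^sub>R 1 - a) \<le> t"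
    using assms by (rule selfadjoint_square_norm)
  from selfadjoint_root_exists[OF selfadjoint_square_star[OF assms] t]
  obtain s where s: "star s = s" "s * s = a" "\<And>c. c * a = a * c \<Longrightarrow> c * s = s * c"
    "norm (sqrt t *\<^sub>R 1 - s) \<le> sqrt t" by blast
  have "0 < sqrt t" using t by simp
  then have "selfadjoint_square s"
    unfolding selfadjoint_square_iff_norm using s(1,4) by blast
  then show ?thesis using s that by blast
qed

lemma selfadjoint_square_add:
  assumes "selfadjoint_square a" "selfadjoint_square b"
  shows "selfadjoint_square (a + b)"
proof -
  obtain t where t: "0 < t" "norm (t *\<^sub>R 1 - a) \<le> t"
    using assms(1) by (rule selfadjoint_square_norm)
  obtain u where u: "0 < u" "norm (u *\<^sub>R 1 - b) \<le> u"
    using assms(2) by (rule selfadjoint_square_norm)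
  have "norm ((t + u) *\<^sub>R 1 - (a + b)) = norm ((t *\<^sub>R 1 - a) + (u *\<^sub>R 1 - b))"
    by (simp add: algebra_simps)
  also have "\<dots> \<le> t + u" using t u norm_triangle_mono by blast
  finally show ?thesis
    using t u assms by (auto simp: selfadjoint_square_iff_norm star_add intro!: exI[of _ "t + u"])
qed

lemma selfadjoint_square_scaleR:
  assumes "selfadjoint_square a" "0 \<le> r"
  shows "selfadjoint_square (r *\<^sub>R a)"
proof -
  obtain s where "star s = s" "a = s * s" using assms by (auto simp: selfadjoint_square_def)
  then show ?thesis
    using assms(2) unfolding selfadjoint_square_def
    by (intro exI[of _ "sqrt r *\<^sub>R s"]) (simp add: star_scaleR)
qed

text \<open>The roots inherit commutation: \<open>s\<close> commutes with \<open>b\<close>, hence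
  \<open>r\<close> with \<open>s\<close>, and \<open>a * b\<close> is the square of
  \<open>s * r\<close>.\<close>

lemma selfadjoint_square_mult:
  assumes "selfadjoint_square a" "selfadjoint_square b" "a * b = b * a"
  shows "selfadjoint_square (a * b)"
proof -
  obtain s where s: "selfadjoint_square s" "s * s = a" "\<And>c. c * a = a * c \<Longrightarrow> c * s = s * c"
    using assms(1) by (rule selfadjoint_square_root) blast
  obtain r where r: "selfadjoint_square r" "r * r = b" "\<And>c. c * b = b * c \<Longrightarrow> c * r = r * c"
    using assms(2) by (rule selfadjoint_square_root) blast
  have "b * s = s * b" using s(3) assms(3) by simp
  then have sr: "s * r = r * s" using r(3)[of s] by simp
  have "a * b = (s * r) * (s * r)" 
  proof -
    have "a * b = s * (s * r) * r" by (simp add: s(2)[symmetric] r(2)[symmetric] mult.assoc)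
    also have "\<dots> = s * (r * s) * r" by (simp only: sr)
    also have "\<dots> = (s * r) * (s * r)" by (simp only: mult.assoc)
    finally show ?thesis .
  qed
  moreover have "star (s * r) = s * r"
    using sr s(1) r(1) by (simp add: star_mult selfadjoint_square_star)
  ultimately show ?thesis unfolding selfadjoint_square_def by blast
qed

text \<open>The roots of \<open>c\<close> and \<open>t - c\<close> commute and their squares add up
  to \<open>t\<close>, which is the situation of
  \<open>norm_square_le_of_sum_squares\<close>.\<close>

lemma selfadjoint_square_norm_le:
  assumes c: "selfadjoint_square c" and d: "selfadjoint_square (t *\<^sub>R 1 - c)" and t: "0 \<le> t"
  shows "norm c \<le> t"
proof -
  obtain s where s: "selfadjoint_square s" "s * s = c" "\<And>b. b * c = c * b \<Longrightarrow> b * s = s * b"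
    using c by (rule selfadjoint_square_root) blast
  obtain r where r: "selfadjoint_square r" "r * r = t *\<^sub>R 1 - c"
      "\<And>b. b * (t *\<^sub>R 1 - c) = (t *\<^sub>R 1 - c) * b \<Longrightarrow> b * r = r * b"
    using d by (rule selfadjoint_square_root) blast
  have "(t *\<^sub>R 1 - c) * s = s * (t *\<^sub>R 1 - c)" by (simp flip: s(2) add: algebra_simps)
  then have "s * r = r * s" using r(3)[of s] by simp
  then have "norm (s * s) \<le> t"
    by (intro norm_square_le_of_sum_squares[where r = r])
       (simp_all add: s r t selfadjoint_square_star)
  then show ?thesis by (simp add: s)
qed

lemma selfadjoint_square_antisym:
  assumes "selfadjoint_square a" "selfadjoint_square (- a)"
  shows "a = 0"
  using selfadjoint_square_norm_le[of a 0] assms by simp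

lemma selfadjoint_square_sum_zero:
  assumes "selfadjoint_square a" "selfadjoint_square b" "a + b = 0"
  shows "a = 0"
  using assms selfadjoint_square_antisym by (metis add.inverse_inverse minus_unique)


lemma commute_square: "c * a = a * c \<Longrightarrow> c * (a * a) = a * a * (c::'a::semigroup_mult)"
  by (metis mult.assoc)

lemma selfadjoint_square_square: "star s = s \<Longrightarrow> selfadjoint_square (s * s)"
  by (auto simp: selfadjoint_square_def)

lemma selfadjoint_square_one: "selfadjoint_square 1"
  unfolding selfadjoint_square_def by (intro exI[of _ 1]) simp

lemma selfadjoint_square_norm_minus:
  assumes "star a = a" "norm a \<le> t"
  shows "selfadjoint_square (t *\<^sub>R 1 - a)"
proof (cases "t = 0")
  case True
  then show ?thesis using assms by (auto simp: selfadjoint_square_def intro!: exI[of _ 0])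
next
  case False
  then have "0 < t" using assms(2) norm_ge_zero[of a] by linarith
  then show ?thesis
    using assms by (auto simp: selfadjoint_square_iff_norm star_simps intro!: exI[of _ t])
qed

section \<open>Uniqueness of roots; positive and negative parts\<close>

text \<open>For \<open>v = s - b\<close> the product \<open>v * (s + b)\<close> is \<open>0\<close>,
  so the positive elements \<open>v * v * s\<close> and \<open>v * v * b\<close> add up to
  \<open>0\<close>. Both vanish, and their difference is the cube of \<open>v\<close>.\<close>

lemma selfadjoint_square_root_unique:
  fixes s b :: "'a::cstar_algebra_1"
  assumes s: "selfadjoint_square s" and b: "selfadjoint_square b"
    and eq: "s * s = b * b" and comm: "b * s = s * b"
  shows "s = b"
proof -
  define v where "v = s - b"
  have vs: "star v = v" using s b by (simp add: v_def star_diff selfadjoint_square_star)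
  have c: "v * s = s * v" "v * b = b * v" using comm by (simp_all add: v_def algebra_simps)
  have nn: "selfadjoint_square (v * v * s)" "selfadjoint_square (v * v * b)"
    using c commute_square[of s v] commute_square[of b v]
    by (intro selfadjoint_square_mult selfadjoint_square_square s b vs; simp)+
  have "v * (s + b) = 0" using eq comm by (simp add: v_def algebra_simps)
  then have sum: "v * v * s + v * v * b = 0" by (metis distrib_left mult.assoc mult_zero_right)
  have "v * v * s = 0" "v * v * b = 0"
    using selfadjoint_square_sum_zero[OF nn sum] sum by simp_all
  then have "v * v * v = 0" by (metis v_def diff_self right_diff_distrib)
  then have "v = 0" using selfadjoint_cube_zero vs by blast
  then show ?thesis by (simp add: v_def)
qed

text \<open>With \<open>m\<close> the absolute value of \<open>k\<close>, the parts are half of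
  \<open>m + k\<close> and half of \<open>m - k\<close>. The work lies in their positivity.\<close>

lemma selfadjoint_parts:
  fixes k :: "'a::cstar_algebra_1"
  assumes "star k = k"
  obtains u v where "selfadjoint_square u" "selfadjoint_square v" "k = u - v" "u * v = 0" "v * u = 0"
    "\<And>c. c * k = k * c \<Longrightarrow> c * u = u * c" "\<And>c. c * k = k * c \<Longrightarrow> c * v = v * c"
    "norm u \<le> norm k" "norm v \<le> norm k"
proof -
  obtain m where m: "selfadjoint_square m" "m * m = k * k"
      "\<And>c. c * (k * k) = (k * k) * c \<Longrightarrow> c * m = m * c"
    using selfadjoint_square_root[OF selfadjoint_square_square[OF assms]] by blast
  have ms: "star m = m" using m(1) by (rule selfadjoint_square_star)
  have comm: "c * m = m * c" if "c * k = k * c" for c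
    by (intro m(3) commute_square that)
  have km: "k * m = m * k" by (rule comm) simp
  have nm: "norm m = norm k"
  proof -
    have "(norm m)\<^sup>2 = (norm k)\<^sup>2"
      using m(2) norm_selfadjoint_square[OF ms] norm_selfadjoint_square[OF assms] by simp
    then show ?thesis by simp
  qed
  define u where "u = (1/2) *\<^sub>R (m + k)"
  define v where "v = (1/2) *\<^sub>R (m - k)"
  have us: "star u = u" "star v = v" by (simp_all add: u_def v_def star_simps ms assms)
  have uv: "u * v = 0" "v * u = 0"
    using km m(2) by (simp_all add: u_def v_def algebra_simps)
  have muv: "m = u + v" by (simp add: u_def v_def flip: scaleR_add_right)
  have kuv: "k = u - v" by (simp add: u_def v_def flip: scaleR_diff_right)
  \<comment> \<open>Compare \<open>a\<close> and \<open>b\<close> with their absolute values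
    \<open>w\<close> and \<open>z\<close>. Uniqueness of the root gives \<open>m = w + z\<close>;
    multiplying \<open>a + b = w + z\<close> by \<open>a\<close> leaves
    \<open>a * a = a * w\<close>, so \<open>a - w\<close> has square \<open>0\<close>.\<close>
  have pos: "selfadjoint_square a" if a: "star a = a" "star b = b" "a * b = 0" "b * a = 0" "m = a + b"
      for a b
  proof -
    obtain w where w: "selfadjoint_square w" "w * w = a * a"
        "\<And>c. c * (a * a) = (a * a) * c \<Longrightarrow> c * w = w * c"
      using selfadjoint_square_root[OF selfadjoint_square_square[OF a(1)]] by blast
    obtain z where z: "selfadjoint_square z" "z * z = b * b"
        "\<And>c. c * (b * b) = (b * b) * c \<Longrightarrow> c * z = z * c"
      using selfadjoint_square_root[OF selfadjoint_square_square[OF a(2)]] by blast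
    have st: "star w = w" "star z = z" using w(1) z(1) by (simp_all add: selfadjoint_square_star)
    have wa: "a * w = w * a" "b * w = w * b" and za: "a * z = z * a" "b * z = z * b"
      by (intro w(3) z(3) commute_square; simp add: a(3,4))+
    have wz: "w * z = z * w" by (intro z(3) commute_square) (simp add: wa)
    have prod0: "c * z = 0" if "star c = c" "c * c = a * a" "c * z = z * c" for c
    proof (rule selfadjoint_square_zero)
      show "star (c * z) = c * z" using that st by (simp add: star_mult)
      have "c * z * (c * z) = c * (z * c) * z" by (simp only: mult.assoc)
      also have "\<dots> = c * c * (z * z)" by (simp only: that(3)[symmetric] mult.assoc)
      also have "\<dots> = a * (a * b) * b" by (simp add: that z(2) mult.assoc)
      finally show "c * z * (c * z) = 0" using a(3) by simp
    qed
    have "w * z = 0" "a * z = 0" using prod0[of w] prod0[of a] st w(2) wz za a(1) by auto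
    have "m = w + z"
    proof (rule selfadjoint_square_root_unique)
      show "selfadjoint_square m" "selfadjoint_square (w + z)"
        using m(1) w(1) z(1) by (simp_all add: selfadjoint_square_add)
      show "m * m = (w + z) * (w + z)"
        using \<open>w * z = 0\<close> wz a(3-5) by (simp add: algebra_simps w(2) z(2))
      show "(w + z) * m = m * (w + z)"
        using wa za by (simp add: a(5) algebra_simps)
    qed
    then have "a * a = a * w" using \<open>a * z = 0\<close> a by (metis add.right_neutral distrib_left)
    then have "(a - w) * (a - w) = 0" using wa(1) w(2) by (simp add: algebra_simps)
    moreover have "star (a - w) = a - w" by (simp add: star_diff a st)
    ultimately have "a = w" using selfadjoint_square_zero[of "a - w"] by simp
    then show ?thesis using w(1) by simp
  qed
  show ?thesis
  proof
    show "selfadjoint_square u" "selfadjoint_square v"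
      using pos[of u v] pos[of v u] us uv muv by (simp_all add: add.commute)
    show "k = u - v" "u * v = 0" "v * u = 0" by fact+
    show "c * u = u * c" "c * v = v * c" if "c * k = k * c" for c
      using comm[OF that] that by (simp_all add: u_def v_def algebra_simps)
    show "norm u \<le> norm k" "norm v \<le> norm k"
      using norm_triangle_ineq[of m k] norm_triangle_ineq4[of m k] by (simp_all add: u_def v_def nm)
  qed
qed


section \<open>Positivity of \<open>star b * b\<close>\<close>

text \<open>Up to sign, \<open>h\<close> and \<open>k\<close> are twice the real and imaginary parts
  of \<open>c\<close>; in \<open>h * h + k * k\<close> the terms with \<open>c * c\<close> and its
  adjoint cancel.\<close>

lemma selfadjoint_square_star_mult_add:
  "selfadjoint_square (star c * c + c * star (c::'a::cstar_algebra_1))"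
proof -
  define h where "h = c + star c"
  define k where "k = \<i> *\<^sub>C (c - star c)"
  have "star h = h" by (simp add: h_def star_simps add.commute)
  moreover have "star k = k"
    by (simp add: k_def star_scaleC_i star_diff star_star scaleC_diff_right)
  ultimately have nn: "selfadjoint_square (h * h + k * k)"
    by (intro selfadjoint_square_add selfadjoint_square_square)
  have "k * k = - ((c - star c) * (c - star c))"
    by (simp only: k_def mult_scaleC_left mult_scaleC_right scaleC_i_i)
  then have "h * h + k * k = 2 *\<^sub>R (star c * c + c * star c)"
    by (simp add: h_def scaleR_2 algebra_simps)
  then have "star c * c + c * star c = (1/2) *\<^sub>R (h * h + k * k)" by simp
  then show ?thesis using selfadjoint_square_scaleR[OF nn, of "1/2"] by simp
qed

text \<open>
  With \<open>s\<close> the root of \<open>g\<close> and \<open>d = c s\<close>, both \<open>d\<^sup>* d\<close> and \<open>d d\<^sup>*\<close> are negatives of squares,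
  although their sum is positive.
\<close>

lemma star_mult_self_negative:
  fixes c g :: "'a::cstar_algebra_1"
  assumes g: "selfadjoint_square g" and eq: "star c * c = - g"
  shows "g = 0"
proof -
  obtain s where s: "selfadjoint_square s" "s * s = g"
    using selfadjoint_square_root[OF g] by blast
  have st: "star s = s" "star g = g" using s(1) g by (simp_all add: selfadjoint_square_star)
  define h where "h = c * star c"
  define d where "d = c * s"
  have hs: "star h = h" by (simp add: h_def star_simps)
  have "star d * d = s * (star c * c) * s" by (simp add: d_def star_mult st mult.assoc)
  also have "\<dots> = - (g * g)" by (simp only: eq) (simp add: s(2)[symmetric] mult.assoc)
  finally have 1: "star d * d = - (g * g)" .
  have "d * star d = c * (s * s) * star c" by (simp add: d_def star_mult st mult.assoc)
  also have "\<dots> = - (c * (star c * c) * star c)" by (simp only: s(2) eq) simp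
  also have "\<dots> = - (h * h)" by (simp add: h_def mult.assoc)
  finally have "star d * d + d * star d = - (g * g + h * h)" using 1 by simp
  then have "selfadjoint_square (- (g * g + h * h))"
    using selfadjoint_square_star_mult_add[of d] by simp
  moreover have nn: "selfadjoint_square (g * g)" "selfadjoint_square (h * h)"
    using hs st by (simp_all add: selfadjoint_square_square)
  ultimately have "g * g + h * h = 0"
    by (intro selfadjoint_square_antisym selfadjoint_square_add)
  then have "g * g = 0" using selfadjoint_square_sum_zero nn by blast
  then show ?thesis using selfadjoint_square_zero st(2) by blast
qed

text \<open>Multiplying \<open>b\<close> by the negative part \<open>v\<close> of
  \<open>star b * b\<close> isolates it: \<open>c = b * v\<close> has \<open>star c * c\<close>
  equal to minus the cube of \<open>v\<close>, which forces \<open>v = 0\<close>.\<close>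

lemma selfadjoint_square_star_mult: "selfadjoint_square (star b * (b::'a::cstar_algebra_1))"
proof -
  have "star (star b * b) = star b * b" by (simp add: star_simps)
  then obtain u v where uv: "selfadjoint_square u" "selfadjoint_square v" "star b * b = u - v"
      "u * v = 0" "v * u = 0"
    by (rule selfadjoint_parts)
  have vs: "star v = v" using uv(2) by (rule selfadjoint_square_star)
  have "star (b * v) * (b * v) = v * (star b * b) * v" by (simp add: star_mult vs mult.assoc)
  also have "\<dots> = - (v * v * v)" by (simp add: uv(3-5) algebra_simps)
  finally have eq: "star (b * v) * (b * v) = - (v * v * v)" .
  have "selfadjoint_square (v * v * v)"
    by (intro selfadjoint_square_mult selfadjoint_square_square uv vs) (simp add: mult.assoc)
  from star_mult_self_negative[OF this eq] have "v = 0" using selfadjoint_cube_zero vs by blast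
  then show ?thesis using uv by simp
qed

lemma cstar_positive_iff: "cstar_positive a \<longleftrightarrow> selfadjoint_square a"
  unfolding cstar_positive_def
  by (metis selfadjoint_square_def selfadjoint_square_star_mult)

lemma cstar_sqrt_square:
  assumes "selfadjoint_square a"
  shows "cstar_sqrt a * cstar_sqrt a = a"
    and "selfadjoint_square (cstar_sqrt a)"
proof -
  obtain s where s: "selfadjoint_square s" "s * s = a" "\<And>c. c * a = a * c \<Longrightarrow> c * s = s * c"
    using selfadjoint_square_root[OF assms] by blast
  have "cstar_sqrt a = s"
    unfolding cstar_sqrt_def cstar_positive_iff
  proof (rule the_equality)
    show "selfadjoint_square s \<and> s * s = a" using s(1,2) by simp
    show "b = s" if b: "selfadjoint_square b \<and> b * b = a" for b
    proof -
      \<comment> \<open>\<open>b\<close> commutes with its square \<open>a\<close>, and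
        \<open>s\<close> commutes with everything that commutes with \<open>a\<close>.\<close>
      have "b * s = s * b" using b by (intro s(3)) (auto simp: mult.assoc)
      then show ?thesis
        using selfadjoint_square_root_unique[OF s(1), of b] b s(2) by simp
    qed
  qed
  then show "cstar_sqrt a * cstar_sqrt a = a" "selfadjoint_square (cstar_sqrt a)"
    using s(1,2) by simp_all
qed

section \<open>Shifted inverses and cutoffs\<close>

lemma neumann_inverse:
  fixes x :: "'a::cstar_algebra_1"
  assumes "norm x < 1"
  obtains g where "(1 - x) * g = 1" "g * (1 - x) = 1"
proof -
  have sm: "summable (\<lambda>n. x ^ n)"
  proof (rule summable_comparison_test)
    show "\<exists>N. \<forall>n\<ge>N. norm (x ^ n) \<le> norm x ^ n" by (simp add: norm_power_ineq)
    show "summable (\<lambda>n. norm x ^ n)" using assms by (simp add: summable_geometric)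
  qed
  have "(\<Sum>n. x ^ n) = 1 + (\<Sum>n. x ^ Suc n)"
    using suminf_split_head[OF sm] by simp
  moreover have "(\<Sum>n. x ^ Suc n) = x * (\<Sum>n. x ^ n)"
    using suminf_mult[OF sm, of x] by simp
  moreover have "(\<Sum>n. x ^ Suc n) = (\<Sum>n. x ^ n) * x"
    using suminf_mult2[OF sm, of x] by (simp add: power_Suc2 del: power_Suc)
  ultimately show ?thesis by (intro that[of "\<Sum>n. x ^ n"]) (simp_all add: algebra_simps)
qed

text \<open>\<open>p + e\<close> is \<open>t + e\<close> times \<open>1 - x\<close>, where
  \<open>x\<close> has norm at most \<open>t / (t + e)\<close>, so the Neumann series
  converges.\<close>

lemma selfadjoint_square_shift_inverse:
  fixes p :: "'a::cstar_algebra_1"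
  assumes p: "selfadjoint_square p" and e: "0 < e"
  obtains g where "selfadjoint_square g" "(p + e *\<^sub>R 1) * g = 1" "g * (p + e *\<^sub>R 1) = 1"
    "\<And>c. c * p = p * c \<Longrightarrow> c * g = g * c"
proof -
  obtain t where t: "0 < t" "norm (t *\<^sub>R 1 - p) \<le> t" using p by (rule selfadjoint_square_norm)
  define x where "x = (1 / (t + e)) *\<^sub>R (t *\<^sub>R 1 - p)"
  have "norm x < 1" using t e by (simp add: x_def divide_simps)
  then obtain g0 where g0: "(1 - x) * g0 = 1" "g0 * (1 - x) = 1" by (rule neumann_inverse)
  define g where "g = (1 / (t + e)) *\<^sub>R g0"
  define m where "m = p + e *\<^sub>R 1"
  have "(t + e) *\<^sub>R (1 - x) = m"
    using t e by (simp add: x_def m_def scaleR_diff_right scaleR_add_left)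
  then have mx: "1 - x = (1 / (t + e)) *\<^sub>R m" using t e by auto
  have g: "m * g = 1" "g * m = 1" using g0 by (simp_all add: g_def mx)
  have ps: "star p = p" using p by (rule selfadjoint_square_star)
  have gc: "c * g = g * c" if "c * p = p * c" for c
  proof -
    have "c * m = m * c" using that by (simp add: m_def algebra_simps)
    then have "g * (c * m) * g = g * (m * c) * g" by simp
    also have "g * (m * c) * g = (g * m) * (c * g)" by (simp only: mult.assoc)
    also have "g * (c * m) * g = (g * c) * (m * g)" by (simp only: mult.assoc)
    finally show ?thesis by (simp add: g)
  qed
  have "star g = star g * (m * g)" by (simp add: g)
  also have "\<dots> = star (m * g) * g" by (simp add: m_def star_simps ps mult.assoc)
  finally have gs: "star g = g" by (simp add: g)
  have "selfadjoint_square m"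
    unfolding m_def using e by (intro selfadjoint_square_add selfadjoint_square_scaleR p selfadjoint_square_one) simp
  \<comment> \<open>Positivity of the inverse is read off from \<open>g = g * g * m\<close>, a
    product of commuting positive elements.\<close>
  then have "selfadjoint_square (g * g * m)"
    by (intro selfadjoint_square_mult selfadjoint_square_square gs) (simp_all add: g mult.assoc, simp add: mult.assoc[symmetric] g)
  then have "selfadjoint_square g" by (simp add: mult.assoc g)
  then show ?thesis using that g gc unfolding m_def by blast
qed

lemma mult_shift_eq_zero:
  fixes p :: "'a::cstar_algebra_1"
  assumes "selfadjoint_square p" "0 < e" "a * (p + e *\<^sub>R 1) = 0"
  shows "a = 0"
proof -
  obtain g where "(p + e *\<^sub>R 1) * g = 1"
    using selfadjoint_square_shift_inverse[OF assms(1,2)] by blast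
  then show ?thesis by (metis assms(3) mult.assoc mult.right_neutral mult_zero_left)
qed

text \<open>A substitute for cutting the spectrum of \<open>b\<close> at \<open>t\<close>:
  \<open>u\<close> lives below and \<open>v\<close> above. The bound on \<open>u\<close> comes from
  \<open>u * b\<close>, which is positive and equals \<open>t u - u * u\<close>, so that
  \<open>u * u\<close> is at most \<open>t\<close> times \<open>u\<close>.\<close>

lemma selfadjoint_cut:
  fixes b :: "'a::cstar_algebra_1"
  assumes b: "selfadjoint_square b" and t: "0 \<le> t"
  obtains u v where "selfadjoint_square u" "selfadjoint_square v" "t *\<^sub>R 1 - b = u - v"
    "u * v = 0" "v * u = 0"
    "\<And>c. c * b = b * c \<Longrightarrow> c * u = u * c" "\<And>c. c * b = b * c \<Longrightarrow> c * v = v * c"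
    "norm u \<le> t"
proof -
  have "star (t *\<^sub>R 1 - b) = t *\<^sub>R 1 - b" using b by (simp add: star_simps selfadjoint_square_star)
  then obtain u v where uv: "selfadjoint_square u" "selfadjoint_square v" "t *\<^sub>R 1 - b = u - v"
    "u * v = 0" "v * u = 0"
    "\<And>c. c * (t *\<^sub>R 1 - b) = (t *\<^sub>R 1 - b) * c \<Longrightarrow> c * u = u * c"
    "\<And>c. c * (t *\<^sub>R 1 - b) = (t *\<^sub>R 1 - b) * c \<Longrightarrow> c * v = v * c"
    by (rule selfadjoint_parts) blast
  have c: "c * u = u * c" "c * v = v * c" if "c * b = b * c" for c
    using that by (auto intro!: uv(6,7) simp: algebra_simps)
  have us: "star u = u" using uv(1) by (rule selfadjoint_square_star)
  have bu: "b * u = u * b" by (rule c(1)) simp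
  have ub: "selfadjoint_square (u * b)" using uv(1) b bu by (intro selfadjoint_square_mult) auto
  have "b = t *\<^sub>R 1 - u + v" using uv(3) by (simp add: algebra_simps)
  then have "u * b = u * (t *\<^sub>R 1 - u + v)" by (rule arg_cong)
  then have eq: "u * b = t *\<^sub>R u - u * u" by (simp add: uv(4) right_diff_distrib distrib_left)
  have "norm (u * u) \<le> t * norm u"
  proof (rule selfadjoint_square_norm_le)
    show "selfadjoint_square (u * u)" by (rule selfadjoint_square_square[OF us])
    have "(t * norm u) *\<^sub>R 1 - u * u = t *\<^sub>R (norm u *\<^sub>R 1 - u) + u * b"
      by (simp add: eq algebra_simps)
    then show "selfadjoint_square ((t * norm u) *\<^sub>R 1 - u * u)"
      using ub t by (simp add: selfadjoint_square_add selfadjoint_square_scaleR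
          selfadjoint_square_norm_minus us)
  qed (use t in simp)
  then have "norm u * norm u \<le> t * norm u" by (simp add: norm_selfadjoint_square us power2_eq_square)
  then have "norm u \<le> t" using t by (cases "norm u = 0") auto
  with uv(1-5) c show ?thesis using that by blast
qed

section \<open>Commutation from vanishing compressions\<close>

lemma zero_of_norm_le_scale:
  fixes x :: "'a::real_normed_vector"
  assumes "\<And>e. 0 < e \<Longrightarrow> norm x \<le> e * K"
  shows "x = 0"
proof -
  have "norm x \<le> 0"
  proof (rule field_le_epsilon)
    fix e :: real assume "0 < e"
    have K: "0 \<le> K" using assms[of 1] norm_ge_zero[of x] by (simp del: norm_ge_zero)
    have "norm x \<le> e / (K + 1) * K" using \<open>0 < e\<close> K by (intro assms) simp
    also have "\<dots> \<le> e" using \<open>0 < e\<close> K by (simp add: divide_simps mult_left_mono)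
    finally show "norm x \<le> 0 + e" by simp
  qed
  then show ?thesis by simp
qed

text \<open>
  Up to a small error \<open>b\<close> is its part \<open>v\<close> above \<open>e\<close>, and \<open>d v\<close> is fixed by the cutoff \<open>1 - u / e\<close>,
  where \<open>u\<close> is the positive part of \<open>e - b\<close>; the factor \<open>a d\<close> kills that cutoff.
\<close>

lemma disjoint_compression_square:
  fixes d p :: "'a::cstar_algebra_1"
  assumes H: "\<And>a b. star a = a \<Longrightarrow> star b = b \<Longrightarrow> a * p = p * a \<Longrightarrow> b * p = p * b \<Longrightarrow> a * b = 0
      \<Longrightarrow> a * d * b = 0"
    and a: "star a = a" "a * p = p * a" and b: "selfadjoint_square b" "b * p = p * b"
    and ab: "a * b = 0"
  shows "a * d * d * b = 0"
proof (rule zero_of_norm_le_scale)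
  fix e :: real assume e: "0 < e"
  have bs: "star b = b" using b(1) by (rule selfadjoint_square_star)
  have ba: "b * a = 0" using arg_cong[OF ab, of star] by (simp add: star_mult a bs)
  obtain u v where uv: "selfadjoint_square u" "selfadjoint_square v" "e *\<^sub>R 1 - b = u - v"
    "u * v = 0" "v * u = 0"
    "\<And>c. c * b = b * c \<Longrightarrow> c * u = u * c" "\<And>c. c * b = b * c \<Longrightarrow> c * v = v * c"
    "norm u \<le> e"
    using selfadjoint_cut[OF b(1) less_imp_le[OF e]] by blast
  have us: "star u = u" "star v = v" using uv(1,2) by (simp_all add: selfadjoint_square_star)
  have pu: "u * p = p * u" "v * p = p * v" using uv(6)[of p] uv(7)[of p] b(2) by simp_all
  have bv: "b = e *\<^sub>R 1 - u + v" using uv(3) by (simp add: algebra_simps)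
  \<comment> \<open>On \<open>v\<close> the element \<open>b\<close> acts as \<open>v + e\<close>,
    which is invertible; so \<open>a\<close> kills \<open>v\<close>, and therefore also the
    remaining part \<open>e - u\<close> of \<open>b\<close>.\<close>
  have "0 = a * b * v" by (simp add: ab)
  also have "\<dots> = a * v * (v + e *\<^sub>R 1)" by (subst bv) (simp add: uv(4) algebra_simps)
  finally have "a * v = 0" using mult_shift_eq_zero[OF uv(2) e] by metis
  then have "a * (e *\<^sub>R 1 - u) = 0" using ab by (subst (asm) bv) (simp add: algebra_simps)
  then have 1: "a * d * (e *\<^sub>R 1 - u) = 0"
    by (intro H) (simp_all add: a us star_simps pu algebra_simps)
  have 2: "u * d * v = 0" by (intro H us pu uv)
  have "e *\<^sub>R (a * d * d * v) = a * d * (e *\<^sub>R 1 - u) * (d * v) + a * d * (u * d * v)"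
    by (simp add: algebra_simps)
  then have "a * d * d * v = 0" using 1 2 e by simp
  then have "a * d * d * b = a * d * d * (e *\<^sub>R 1 - u)" by (subst bv) (simp add: algebra_simps)
  also have "norm \<dots> \<le> norm (a * d * d) * (e + e)"
  proof (rule order_trans[OF norm_mult_ineq], rule mult_left_mono)
    show "norm (e *\<^sub>R 1 - u) \<le> e + e"
      using norm_triangle_ineq4[of "e *\<^sub>R 1" u] e uv(8) by simp
  qed simp
  finally show "norm (a * d * d * b) \<le> e * (2 * norm (a * d * d))" by (simp add: algebra_simps)
qed

text \<open>\<open>S\<close> and \<open>T\<close> annihilate each other, so the product of the
  positive elements \<open>M\<^sup>2 - S\<close> and \<open>M\<^sup>2 - T\<close> is
  \<open>M\<^sup>2\<close> times \<open>M\<^sup>2 - (S + T)\<close>. This bounds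
  \<open>S + T\<close>, which is \<open>star (a - b) * (a - b)\<close>.\<close>

lemma norm_diff_le_of_orthogonal:
  fixes a b :: "'a::cstar_algebra_1"
  assumes z: "star a * b = 0" "a * star b = 0" and n: "norm a \<le> M" "norm b \<le> M"
  shows "norm (a - b) \<le> M"
proof (cases "M = 0")
  case False
  then have M: "0 < M" using n norm_ge_zero[of a] by linarith
  define S where "S = star a * a"
  define T where "T = star b * b"
  have z': "star b * a = 0" "b * star a = 0"
    using arg_cong[OF z(1), of star] arg_cong[OF z(2), of star] by (simp_all add: star_simps)
  have "S * T = star a * (a * star b) * b" "T * S = star b * (b * star a) * a"
    by (simp_all add: S_def T_def mult.assoc)
  then have ST: "S * T = 0" "T * S = 0" using z z' by simp_all
  have nn: "selfadjoint_square S" "selfadjoint_square T"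
    by (simp_all add: S_def T_def selfadjoint_square_star_mult)
  have "norm S \<le> M\<^sup>2" "norm T \<le> M\<^sup>2"
    using n by (simp_all add: S_def T_def norm_star_mult_self power_mono)
  then have "selfadjoint_square (M\<^sup>2 *\<^sub>R 1 - S)" "selfadjoint_square (M\<^sup>2 *\<^sub>R 1 - T)"
    using nn by (simp_all add: selfadjoint_square_norm_minus selfadjoint_square_star)
  then have "selfadjoint_square ((M\<^sup>2 *\<^sub>R 1 - S) * (M\<^sup>2 *\<^sub>R 1 - T))"
    by (rule selfadjoint_square_mult) (simp add: ST algebra_simps)
  also have "(M\<^sup>2 *\<^sub>R 1 - S) * (M\<^sup>2 *\<^sub>R 1 - T) = M\<^sup>2 *\<^sub>R (M\<^sup>2 *\<^sub>R 1 - (S + T))"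
    by (simp add: ST algebra_simps)
  finally have "selfadjoint_square ((1 / M\<^sup>2) *\<^sub>R (M\<^sup>2 *\<^sub>R (M\<^sup>2 *\<^sub>R 1 - (S + T))))"
    by (rule selfadjoint_square_scaleR) simp
  then have "selfadjoint_square (M\<^sup>2 *\<^sub>R 1 - (S + T))" using M by simp
  then have "norm (S + T) \<le> M\<^sup>2"
    using nn by (intro selfadjoint_square_norm_le selfadjoint_square_add) simp_all
  moreover have "star (a - b) * (a - b) = S + T"
    by (simp add: S_def T_def star_diff z z' algebra_simps)
  ultimately have "(norm (a - b))\<^sup>2 \<le> M\<^sup>2" using norm_star_mult_self[of "a - b"] by simp
  then show ?thesis by (rule power2_le_imp_le) (use M in simp)
qed (use n in simp)

text \<open>
  The commutators of \<open>d\<close> with the positive and the negative part of \<open>h\<close> are orthogonal, and each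
  part lies in an interval of half the length; so every bisection halves the bound.
\<close>

lemma disjoint_compression_commute:
  fixes d p :: "'a::cstar_algebra_1"
  assumes d: "star d = d"
    and H: "\<And>a b. star a = a \<Longrightarrow> star b = b \<Longrightarrow> a * p = p * a \<Longrightarrow> b * p = p * b \<Longrightarrow> a * b = 0
      \<Longrightarrow> a * d * b = 0"
    and h: "star h = h" "h * p = p * h"
  shows "h * d = d * h"
proof -
  have bound: "norm (h * d - d * h) \<le> 2 * \<rho> * norm d / 2 ^ n"
    if "star h = h" "h * p = p * h" "norm h \<le> \<rho>" for h \<rho> n
    using that
  proof (induction n arbitrary: h \<rho>)
    case 0
    have "norm (h * d - d * h) \<le> norm h * norm d + norm d * norm h"
      by (rule order_trans[OF norm_triangle_ineq4]) (intro add_mono norm_mult_ineq)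
    also have "\<dots> \<le> \<rho> * norm d + norm d * \<rho>"
      using 0 by (intro add_mono mult_mono) (auto intro: order_trans[OF norm_ge_zero])
    finally show ?case by (simp add: algebra_simps)
  next
    case (Suc n)
    have \<rho>: "0 \<le> \<rho>" using Suc.prems(3) norm_ge_zero[of h] by linarith
    obtain u v where uv: "selfadjoint_square u" "selfadjoint_square v" "h = u - v"
        "u * v = 0" "v * u = 0" "\<And>c. c * h = h * c \<Longrightarrow> c * u = u * c"
        "\<And>c. c * h = h * c \<Longrightarrow> c * v = v * c" "norm u \<le> norm h" "norm v \<le> norm h"
      using selfadjoint_parts[OF Suc.prems(1)] by blast
    have half: "norm (w * d - d * w) \<le> 2 * \<rho> * norm d / 2 ^ Suc n"
      if w: "selfadjoint_square w" "w * p = p * w" "norm w \<le> \<rho>" for w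
    proof -
      \<comment> \<open>Subtracting a scalar leaves the commutator unchanged, and centring the
        interval from \<open>0\<close> to \<open>\<rho>\<close> halves the norm bound.\<close>
      define x where "x = w - (\<rho>/2) *\<^sub>R 1"
      have ws: "star w = w" using w(1) by (rule selfadjoint_square_star)
      have xs: "star x = x" by (simp add: x_def star_simps ws)
      have "norm (x * x) \<le> (\<rho>/2)\<^sup>2"
      proof (rule selfadjoint_square_norm_le)
        show "selfadjoint_square (x * x)" by (rule selfadjoint_square_square[OF xs])
        have "selfadjoint_square (w * (\<rho> *\<^sub>R 1 - w))"
          by (intro selfadjoint_square_mult selfadjoint_square_norm_minus w ws)
             (simp add: algebra_simps)
        moreover have "(\<rho>/2)\<^sup>2 *\<^sub>R 1 - x * x = w * (\<rho> *\<^sub>R 1 - w)"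
        proof -
          have "(\<rho>/2) *\<^sub>R w + (\<rho>/2) *\<^sub>R w = \<rho> *\<^sub>R w" by (simp flip: scaleR_add_left)
          then show ?thesis by (simp add: x_def algebra_simps power2_eq_square)
        qed
        ultimately show "selfadjoint_square ((\<rho>/2)\<^sup>2 *\<^sub>R 1 - x * x)" by simp
      qed simp
      then have "(norm x)\<^sup>2 \<le> (\<rho>/2)\<^sup>2" by (simp only: norm_selfadjoint_square[OF xs])
      then have "norm x \<le> \<rho>/2" by (rule power2_le_imp_le) (use \<rho> in simp)
      moreover have "x * p = p * x" using w(2) by (simp add: x_def algebra_simps)
      ultimately have "norm (x * d - d * x) \<le> 2 * (\<rho>/2) * norm d / 2 ^ n"
        by (intro Suc.IH xs)
      moreover have "x * d - d * x = w * d - d * w" by (simp add: x_def algebra_simps)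
      ultimately show ?thesis by simp
    qed
    have ps: "u * p = p * u" "v * p = p * v" using uv(6)[of p] uv(7)[of p] Suc.prems(2) by simp_all
    have ss: "star u = u" "star v = v" using uv(1,2) by (simp_all add: selfadjoint_square_star)
    have udv: "u * d * v = 0" by (intro H ss ps uv)
    \<comment> \<open>In the product of the two commutators this is the one term that
      \<open>u * v = 0\<close> and \<open>u * d * v = 0\<close> do not remove.\<close>
    have uddv: "u * d * d * v = 0"
      by (rule disjoint_compression_square[OF H ss(1) ps(1) uv(2) ps(2) uv(4)])
    have "u * (d * v) = 0" "u * (d * (d * v)) = 0" using udv uddv by (simp_all add: mult.assoc)
    moreover from this have "u * (d * (v * d)) = 0" "u * (v * d) = 0"
      using uv(4) by (simp_all flip: mult.assoc)
    ultimately have N: "(u * d - d * u) * (v * d - d * v) = 0"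
      by (simp add: algebra_simps)
    have st: "star (u * d - d * u) = - (u * d - d * u)" "star (v * d - d * v) = - (v * d - d * v)"
      by (simp_all add: star_simps ss d)
    have "norm ((u * d - d * u) - (v * d - d * v)) \<le> 2 * \<rho> * norm d / 2 ^ Suc n"
    proof (rule norm_diff_le_of_orthogonal)
      show "star (u * d - d * u) * (v * d - d * v) = 0"
        unfolding st using N by (simp only: mult_minus_left neg_equal_0_iff_equal)
      show "(u * d - d * u) * star (v * d - d * v) = 0"
        unfolding st using N by (simp only: mult_minus_right neg_equal_0_iff_equal)
      show "norm (u * d - d * u) \<le> 2 * \<rho> * norm d / 2 ^ Suc n"
        "norm (v * d - d * v) \<le> 2 * \<rho> * norm d / 2 ^ Suc n"
        using half[OF uv(1) ps(1)] half[OF uv(2) ps(2)] uv(8,9) Suc.prems(3) by linarith+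
    qed
    moreover have "h * d - d * h = (u * d - d * u) - (v * d - d * v)"
      by (simp add: uv(3) algebra_simps)
    ultimately show ?case by simp
  qed
  have "(\<lambda>n. 2 * norm h * norm d * (1/2) ^ n) \<longlonglongrightarrow> 2 * norm h * norm d * 0"
    by (intro tendsto_intros) simp
  then have "norm (h * d - d * h) \<le> 2 * norm h * norm d * 0"
    by (rule LIMSEQ_le_const) (use bound[OF h order_refl] in \<open>simp add: power_divide\<close>)
  then show ?thesis by simp
qed


section \<open>Hilbert modules\<close>

lemma module_abs_square:
  assumes "hilbert_module sm ip"
  shows "(module_abs ip x)\<^sup>2 = ip x x"
  using cstar_sqrt_square(1)[of "ip x x"] hilbert_module.ip_positive[OF assms, of x]
  by (simp add: module_abs_def cstar_positive_iff power2_eq_square)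

context hilbert_module
begin

lemma ip_zero_left [simp]: "ip 0 y = 0"
  using ip_add_left[of 0 0 y] by simp

lemma ip_zero_right [simp]: "ip x 0 = 0"
  using ip_star[of 0 x] by simp

lemma ip_minus_left: "ip (- x) y = - ip x y"
  using ip_add_left[of x "- x" y] by (simp add: minus_unique)

lemma ip_diff_left: "ip (x - z) y = ip x y - ip z y"
  using ip_add_left[of x "- z" y] by (simp add: ip_minus_left)

lemma ip_add_right: "ip x (y + z) = ip x y + ip x z"
  by (metis ip_add_left ip_star star_add)

lemma ip_diff_right: "ip x (y - z) = ip x y - ip x z"
  by (metis ip_diff_left ip_star star_diff)

lemma ip_sm_right: "ip x (sm a y) = ip x y * star a"
  by (metis ip_sm_left ip_star star_mult)

lemma selfadjoint_square_ip: "selfadjoint_square (ip x x)"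
  using ip_positive by (simp add: cstar_positive_iff)

lemma norm_ip_self: "norm (ip x x) = (norm x)\<^sup>2"
proof -
  have "selfadjoint_square (cstar_sqrt (ip x x))"
    by (rule cstar_sqrt_square(2)[OF selfadjoint_square_ip])
  then have "norm (cstar_sqrt (ip x x) * cstar_sqrt (ip x x)) = (norm (cstar_sqrt (ip x x)))\<^sup>2"
    by (intro norm_selfadjoint_square selfadjoint_square_star)
  then show ?thesis
    by (simp add: cstar_sqrt_square(1)[OF selfadjoint_square_ip] norm_eq module_abs_def)
qed

text \<open>Since \<open>ip y y\<close> may be singular, \<open>x\<close> is not projected along
  \<open>y\<close>. For \<open>norm y \<le> 1\<close> one subtracts \<open>sm a y\<close> with
  \<open>a = ip x y\<close>; the defect \<open>a * (1 - ip y y) * star a\<close> is still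
  positive.\<close>

lemma cauchy_schwarz: "norm (ip x y) \<le> norm x * norm y"
proof -
  have unit: "norm (ip x y) \<le> norm x" if y: "norm y \<le> 1" for x y
  proof -
    define a where "a = ip x y"
    have sa: "star a = ip y x" by (simp add: a_def ip_star)
    obtain s where s: "star s = s" "1 - ip y y = s * s"
    proof -
      have "norm (ip y y) \<le> 1" using y by (simp add: norm_ip_self power_le_one)
      then have "selfadjoint_square (1 *\<^sub>R 1 - ip y y)"
        by (intro selfadjoint_square_norm_minus) (simp_all add: ip_star)
      then show ?thesis using that by (auto simp: selfadjoint_square_def)
    qed
    have "ip x x - a * star a = ip (x - sm a y) (x - sm a y) + a * (1 - ip y y) * star a"
      by (simp add: ip_diff_left ip_diff_right ip_sm_left ip_sm_right sa[symmetric] a_def[symmetric]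
          algebra_simps)
    also have "a * (1 - ip y y) * star a = star (s * star a) * (s * star a)"
      by (simp add: s star_simps mult.assoc)
    finally have 1: "selfadjoint_square (ip x x - a * star a)"
      by (simp add: selfadjoint_square_add selfadjoint_square_ip selfadjoint_square_star_mult)
    have "norm (a * star a) \<le> (norm x)\<^sup>2"
    proof (rule selfadjoint_square_norm_le)
      show "selfadjoint_square (a * star a)"
        using selfadjoint_square_star_mult[of "star a"] by (simp add: star_star)
      have "selfadjoint_square ((norm x)\<^sup>2 *\<^sub>R 1 - ip x x)"
        by (intro selfadjoint_square_norm_minus) (simp_all add: ip_star norm_ip_self)
      from selfadjoint_square_add[OF this 1]
      show "selfadjoint_square ((norm x)\<^sup>2 *\<^sub>R 1 - a * star a)" by simp
    qed simp
    then have "(norm a)\<^sup>2 \<le> (norm x)\<^sup>2" by (simp add: norm_mult_star_self)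
    then show ?thesis unfolding a_def by (rule power2_le_imp_le) simp
  qed
  show ?thesis
  proof (cases "y = 0")
    case False
    define r where "r = 1 / norm y"
    have "ip x (r *\<^sub>R y) = r *\<^sub>R ip x y"
      using ip_sm_right[of x "r *\<^sub>R 1" y] by (simp add: sm_scaleR star_scaleR)
    moreover have "norm (ip x (r *\<^sub>R y)) \<le> norm x"
      by (rule unit) (use False in \<open>simp add: r_def\<close>)
    ultimately show ?thesis using False by (simp add: r_def divide_simps)
  qed simp
qed

lemma full_annihilator_zero:
  assumes full: "full_module ip" and c: "\<And>x y. c * ip x y = 0"
  shows "c = 0"
proof -
  \<comment> \<open>The free factor \<open>d\<close> makes the annihilator of \<open>c\<close> a
    two-sided ideal.\<close>
  define I where "I = {a. \<forall>d. c * d * a = 0}"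
  have "two_sided_ideal hull {ip x y |x y. True} \<subseteq> I"
  proof (rule hull_minimal)
    show "{ip x y |x y. True} \<subseteq> I"
      using c by (auto simp: I_def mult.assoc simp flip: ip_sm_left)
    show "two_sided_ideal I"
      by (auto simp: I_def two_sided_ideal_def distrib_left) (metis mult.assoc mult_zero_left)+
  qed
  then have "1 \<in> I" using full by (auto simp: full_module_def)
  then have "c * 1 * 1 = 0" unfolding I_def by blast
  then show ?thesis by simp
qed

end


section \<open>Orthogonality preserving forms\<close>

text \<open>\<open>D\<close> abstracts the pullback of the inner product along
  \<open>\<Psi>\<close>.\<close>

locale orthogonality_form = hilbert_module sm ip
  for sm :: "'a::cstar_algebra_1 \<Rightarrow> 'e::banach \<Rightarrow> 'e" and ip +
  fixes D :: "'e \<Rightarrow> 'e \<Rightarrow> 'a"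
  assumes form_add_left: "D (x + y) z = D x z + D y z"
    and form_sm_left: "D (sm a x) y = a * D x y"
    and form_star: "star (D x y) = D y x"
    and form_orthogonal: "ip x y = 0 \<Longrightarrow> D x y = 0"
begin

lemma form_add_right: "D x (y + z) = D x y + D x z"
  by (metis form_add_left form_star star_add)

lemma form_sm_right: "D x (sm a y) = D x y * star a"
  by (metis form_sm_left form_star star_mult)

lemma form_diff_right: "D x (y - z) = D x y - D x z"
  using form_add_right[of x "y - z" z] by simp

lemma form_self_commute:
  assumes "star h = h" "h * ip y y = ip y y * h"
  shows "h * D y y = D y y * h"
proof (rule disjoint_compression_commute[where p = "ip y y"])
  show "star (D y y) = D y y" by (rule form_star)
  fix a b :: 'a
  assume a: "star a = a" "a * ip y y = ip y y * a" and b: "star b = b" and ab: "a * b = 0"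
  have "ip (sm a y) (sm b y) = ip y y * (a * b)"
    by (simp add: ip_sm_left ip_sm_right a b flip: mult.assoc)
  then have "D (sm a y) (sm b y) = 0" by (intro form_orthogonal) (simp add: ab)
  then show "a * D y y * b = 0" by (simp add: form_sm_left form_sm_right b mult.assoc)
qed fact+

text \<open>
  On the part \<open>v\<close> of the spectrum of \<open>\<langle>y, y\<rangle>\<close> above \<open>e\<close>, the vector \<open>w\<close> can be made orthogonal
  to \<open>y\<close> by subtracting a multiple of \<open>y\<close>.
\<close>

lemma form_proportional_self: "ip y y * D y w = D y y * ip y w"
proof -
  define p where "p = ip y y"
  define \<delta> where "\<delta> = D y y"
  define r where "r = ip y w"
  define \<gamma> where "\<gamma> = D y w"
  define d where "d = p * \<gamma> - \<delta> * r"
  have p: "selfadjoint_square p" by (simp add: p_def selfadjoint_square_ip)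
  have ps: "star p = p" using p by (rule selfadjoint_square_star)
  have "p * d = 0"
  proof (rule zero_of_norm_le_scale)
    fix e :: real assume e: "0 < e"
    obtain u v where uv: "selfadjoint_square u" "selfadjoint_square v" "e *\<^sub>R 1 - p = u - v"
      "u * v = 0" "v * u = 0" "\<And>c. c * p = p * c \<Longrightarrow> c * u = u * c"
      "\<And>c. c * p = p * c \<Longrightarrow> c * v = v * c" "norm u \<le> e"
      using selfadjoint_cut[OF p less_imp_le[OF e]] by blast
    have vs: "star v = v" using uv(2) by (rule selfadjoint_square_star)
    \<comment> \<open>\<open>m = p + u\<close> is \<open>p\<close> with the part of its spectrum
      below \<open>e\<close> raised to \<open>e\<close>. It is invertible and agrees with
      \<open>p\<close> on \<open>v\<close>, so its inverse \<open>g\<close> supplies the coefficient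
      of \<open>y\<close>.\<close>
    define m where "m = v + e *\<^sub>R 1"
    have pm: "p = m - u" using uv(3) by (simp add: m_def algebra_simps)
    obtain g where g: "selfadjoint_square g" "m * g = 1" "g * m = 1"
      "\<And>c. c * v = v * c \<Longrightarrow> c * g = g * c"
      using selfadjoint_square_shift_inverse[OF uv(2) e] unfolding m_def by blast
    have gs: "star g = g" using g(1) by (rule selfadjoint_square_star)
    have vd: "v * \<delta> = \<delta> * v"
      unfolding \<delta>_def by (rule form_self_commute[OF vs]) (use uv(7)[of p] in \<open>simp add: p_def\<close>)
    have gd: "g * \<delta> = \<delta> * g" using g(4)[of \<delta>] vd by simp
    have gv: "v * g = g * v" by (rule g(4)) simp
    have "ip (sm v y) (w - sm (star r * g) y) = v * (r - p * g * r)"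
      by (simp add: ip_sm_left ip_diff_right ip_sm_right star_simps gs p_def r_def mult.assoc
          right_diff_distrib)
    also have "p * g * r = r - u * (g * r)"
      by (simp add: pm left_diff_distrib g(2) mult.assoc)
    also have "v * (r - (r - u * (g * r))) = (v * u) * (g * r)" by (simp add: mult.assoc)
    finally have "ip (sm v y) (w - sm (star r * g) y) = 0" by (simp add: uv(5))
    then have "D (sm v y) (w - sm (star r * g) y) = 0" by (rule form_orthogonal)
    then have "v * (\<gamma> - \<delta> * g * r) = 0"
      by (simp add: form_sm_left form_diff_right form_sm_right star_simps gs \<gamma>_def \<delta>_def r_def
          mult.assoc right_diff_distrib)
    \<comment> \<open>Multiplying by \<open>m\<close> clears \<open>g\<close>; afterwards
      \<open>v * u = 0\<close> allows \<open>m\<close> to be replaced by \<open>p\<close>.\<close>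
    then have "m * (v * (\<gamma> - g * \<delta> * r)) = 0" by (simp add: gd)
    moreover have "m * v = v * m" by (simp add: m_def algebra_simps)
    then have "m * (v * (\<gamma> - g * \<delta> * r)) = v * (m * (\<gamma> - g * \<delta> * r))"
      by (simp flip: mult.assoc)
    moreover have "m * (\<gamma> - g * \<delta> * r) = m * \<gamma> - (m * g) * \<delta> * r"
      by (simp add: right_diff_distrib mult.assoc)
    moreover have "m = p + u" by (simp add: pm)
    then have "v * (m * \<gamma> - \<delta> * r) = v * d + (v * u) * \<gamma>"
      by (simp add: d_def algebra_simps)
    ultimately have vd0: "v * d = 0" by (simp add: g(2) uv(5))
    have "p = e *\<^sub>R 1 - u + v" using uv(3) by (simp add: algebra_simps)
    then have "p * d = (e *\<^sub>R 1 - u) * d" by (simp add: distrib_right vd0)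
    also have "norm \<dots> \<le> (e + e) * norm d"
    proof (rule order_trans[OF norm_mult_ineq], rule mult_right_mono)
      show "norm (e *\<^sub>R 1 - u) \<le> e + e"
        using norm_triangle_ineq4[of "e *\<^sub>R 1" u] e uv(8) by simp
    qed simp
    finally show "norm (p * d) \<le> e * (2 * norm d)" by (simp add: algebra_simps)
  qed
  \<comment> \<open>It remains to remove the factor \<open>p\<close>. From \<open>p * d = 0\<close>
    the vector \<open>sm (star d) y\<close> is \<open>0\<close>, hence
    \<open>star d * \<delta> = 0\<close>, and both terms of \<open>star d * d\<close>
    vanish.\<close>
  then have "ip (sm (star d) y) (sm (star d) y) = 0"
    by (simp add: ip_sm_left ip_sm_right star_star p_def mult.assoc)
  then have zero: "D (sm (star d) y) z = 0" for z
    using ip_definite form_orthogonal[of 0 z] by fastforce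
  have "star d * d = star (p * d) * \<gamma> - (star d * \<delta>) * r"
    by (simp add: star_mult ps) (simp add: d_def right_diff_distrib mult.assoc)
  then have "star d * d = 0"
    using zero[of y] \<open>p * d = 0\<close> by (simp add: form_sm_left \<delta>_def)
  then have "d = 0" using norm_star_mult_self[of d] by simp
  then show ?thesis by (simp add: d_def p_def \<gamma>_def \<delta>_def r_def)
qed

text \<open>With \<open>p * g = 1 - n\<close> inserted in the middle, both sides agree exactly by
  \<open>form_proportional_self\<close>. The two errors contain \<open>n\<close> only through
  \<open>ip x (sm n y)\<close> and \<open>ip (sm n y) w\<close>, which Cauchy-Schwarz controls
  because \<open>sm n y\<close> is small.\<close>

lemma form_proportional_common: "ip x y * D y w = D x y * ip y w"
proof -
  define p where "p = ip y y"
  define \<delta> where "\<delta> = D y y"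
  define q where "q = ip x y"
  define \<beta> where "\<beta> = D x y"
  define r where "r = ip y w"
  define \<gamma> where "\<gamma> = D y w"
  have p: "selfadjoint_square p" by (simp add: p_def selfadjoint_square_ip)
  have pg: "p * \<gamma> = \<delta> * r"
    unfolding p_def \<gamma>_def \<delta>_def r_def by (rule form_proportional_self)
  have bp: "\<beta> * p = q * \<delta>"
    using arg_cong[OF form_proportional_self[of y x], of star]
    by (simp add: star_mult ip_star form_star \<beta>_def p_def q_def \<delta>_def)
  have "q * \<gamma> - \<beta> * r = 0"
  proof (rule zero_of_norm_le_scale)
    fix \<epsilon> :: real assume \<epsilon>: "0 < \<epsilon>"
    \<comment> \<open>The norm of \<open>sm n y\<close> is of order the square root of
      \<open>e\<close>.\<close>
    define e where "e = \<epsilon>\<^sup>2"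
    have e: "0 < e" using \<epsilon> by (simp add: e_def)
    obtain g where g: "selfadjoint_square g" "(p + e *\<^sub>R 1) * g = 1" "g * (p + e *\<^sub>R 1) = 1"
      "\<And>c. c * p = p * c \<Longrightarrow> c * g = g * c"
      using selfadjoint_square_shift_inverse[OF p e] by blast
    define n where "n = e *\<^sub>R g"
    have ng: "selfadjoint_square n" unfolding n_def using g(1) e by (intro selfadjoint_square_scaleR) auto
    have ns: "star n = n" using ng by (rule selfadjoint_square_star)
    have gp: "p * g = g * p" using g(4)[of p] by simp
    have pg1: "p * g = 1 - n" using g(2) by (simp add: n_def algebra_simps)
    have pn: "p * n = e *\<^sub>R (1 - n)" by (simp add: n_def pg1[unfolded n_def])
    have nd: "n * \<delta> = \<delta> * n"
      unfolding \<delta>_def by (rule form_self_commute[OF ns]) (use gp in \<open>simp add: p_def n_def\<close>)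
    have "norm n \<le> 1"
    proof (rule selfadjoint_square_norm_le[OF ng])
      show "selfadjoint_square (1 *\<^sub>R 1 - n)"
        using selfadjoint_square_mult[OF p g(1) gp] by (simp add: pg1)
    qed simp
    have ny: "norm (sm n y) \<le> 2 * \<epsilon>"
    proof (rule power2_le_imp_le)
      have "(norm (sm n y))\<^sup>2 = norm (n * (p * n))"
        by (simp add: norm_ip_self[symmetric] ip_sm_left ip_sm_right ns p_def mult.assoc)
      also have "\<dots> = e * norm (n * (1 - n))" using e by (simp add: pn)
      also have "norm (n * (1 - n)) \<le> 1 * 2"
      proof (rule order_trans[OF norm_mult_ineq], rule mult_mono)
        show "norm (1 - n) \<le> 2" using norm_triangle_ineq4[of 1 n] \<open>norm n \<le> 1\<close> by simp
      qed (use \<open>norm n \<le> 1\<close> in simp_all)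
      also have "e * (1 * 2) \<le> (2 * \<epsilon>)\<^sup>2" by (simp add: e_def power2_eq_square)
      finally show "(norm (sm n y))\<^sup>2 \<le> (2 * \<epsilon>)\<^sup>2" using e by simp
    qed (use \<epsilon> in simp)
    have "q * n = ip x (sm n y)" "n * r = ip (sm n y) w"
      by (simp_all add: q_def r_def ip_sm_left ip_sm_right ns)
    then have "norm (q * n) \<le> norm x * (2 * \<epsilon>)" "norm (n * r) \<le> (2 * \<epsilon>) * norm w"
      using order_trans[OF cauchy_schwarz[of x "sm n y"] mult_left_mono[OF ny norm_ge_zero]]
        order_trans[OF cauchy_schwarz[of "sm n y" w] mult_right_mono[OF ny norm_ge_zero]]
      by simp_all
    then have "norm (q * n * \<gamma>) \<le> norm x * (2 * \<epsilon>) * norm \<gamma>"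
      "norm (\<beta> * (n * r)) \<le> norm \<beta> * ((2 * \<epsilon>) * norm w)"
      by (auto intro!: order_trans[OF norm_mult_ineq] mult_left_mono mult_right_mono)
    moreover have diff: "q * \<gamma> - \<beta> * r = q * n * \<gamma> - \<beta> * (n * r)"
    proof -
      have "g * \<delta> = \<delta> * g" using nd e by (simp add: n_def)
      then have "q * (g * (p * \<gamma>)) = (q * \<delta>) * (g * r)" by (simp add: pg flip: mult.assoc)
      then have "q * ((p * g) * \<gamma>) = \<beta> * ((p * g) * r)"
        by (simp add: gp bp[symmetric] mult.assoc) (simp add: gp flip: mult.assoc)
      then show ?thesis unfolding pg1 by (simp add: algebra_simps)
    qed
    moreover have "norm (q * \<gamma> - \<beta> * r) \<le> norm (q * n * \<gamma>) + norm (\<beta> * (n * r))"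
      unfolding diff by (rule norm_triangle_ineq4)
    ultimately have "norm (q * \<gamma> - \<beta> * r)
        \<le> norm x * (2 * \<epsilon>) * norm \<gamma> + norm \<beta> * ((2 * \<epsilon>) * norm w)" by linarith
    then show "norm (q * \<gamma> - \<beta> * r) \<le> \<epsilon> * (2 * norm x * norm \<gamma> + 2 * norm \<beta> * norm w)"
      by (simp add: distrib_left mult_ac)
  qed
  then show ?thesis by (simp add: q_def \<gamma>_def \<beta>_def r_def)
qed

text \<open>For fixed \<open>x\<close> and \<open>w\<close>, \<open>f\<close> is conjugate linear in
  \<open>y\<close>, linear in \<open>z\<close>, and zero on the diagonal. Expanding \<open>f\<close>
  at \<open>y + z\<close> makes it antisymmetric; replacing \<open>z\<close> by \<open>\<i>\<close>
  times \<open>z\<close> makes it symmetric as well.\<close>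

lemma form_proportional: "ip x y * D z w = D x y * ip z w"
proof -
  define f where "f y z = ip x y * D z w - D x y * ip z w" for y z
  have f0: "f y y = 0" for y by (simp add: f_def form_proportional_common)
  have fs: "f y z + f z y = 0" for y z
    using f0[of "y + z"] f0[of y] f0[of z]
    by (simp add: f_def ip_add_left ip_add_right form_add_left form_add_right algebra_simps)
  have "f y (sm (\<i> *\<^sub>C 1) z) = \<i> *\<^sub>C f y z"
    by (simp add: f_def ip_sm_left form_sm_left mult_scaleC_left mult_scaleC_right scaleC_diff_right)
  moreover have "f (sm (\<i> *\<^sub>C 1) z) y = - (\<i> *\<^sub>C f z y)"
    by (simp add: f_def ip_sm_right form_sm_right star_scaleC_i mult_scaleC_left mult_scaleC_right
        scaleC_diff_right)
  ultimately have "\<i> *\<^sub>C f y z = \<i> *\<^sub>C f z y" using fs[of y "sm (\<i> *\<^sub>C 1) z"] by simp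
  then have "\<i> *\<^sub>C (\<i> *\<^sub>C f y z) = \<i> *\<^sub>C (\<i> *\<^sub>C f z y)" by simp
  then have "f y z = f z y" by (simp only: scaleC_i_i neg_equal_iff_equal)
  with fs[of y z] have "2 *\<^sub>R f y z = 0" by (simp add: scaleR_2)
  then show ?thesis by (simp add: f_def)
qed

text \<open>
  The \<open>a\<close> for which \<open>a D\<close> is a multiple of the inner product, from both sides, form an ideal;
  fullness puts \<open>1\<close> into it.
\<close>

lemma form_eq_central_multiple:
  assumes full: "full_module ip"
  obtains u where "central u" "\<And>x y. D x y = u * ip x y"
proof -
  define J where "J = {a. \<exists>u. \<forall>z w. u * ip z w = a * D z w \<and> ip z w * u = D z w * a}"
  have "two_sided_ideal hull {ip x y |x y. True} \<subseteq> J"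
  proof (rule hull_minimal)
    have "ip x y \<in> J" for x y
      unfolding J_def using form_proportional by (auto intro!: exI[of _ "D x y"])
    then show "{ip x y |x y. True} \<subseteq> J" by auto
    show "two_sided_ideal J"
      unfolding two_sided_ideal_def
    proof (intro conjI ballI allI)
      show "0 \<in> J" by (auto simp: J_def intro!: exI[of _ 0])
      fix a assume "a \<in> J"
      then obtain u where u: "u * ip z w = a * D z w" "ip z w * u = D z w * a" for z w
        by (auto simp: J_def)
      show "a + b \<in> J" if "b \<in> J" for b
      proof -
        obtain v where v: "v * ip z w = b * D z w" "ip z w * v = D z w * b" for z w
          using \<open>b \<in> J\<close> by (auto simp: J_def)
        show ?thesis
          unfolding J_def using u v by (auto intro!: exI[of _ "u + v"] simp: distrib_left distrib_right)
      qed
      \<comment> \<open>The left equation absorbs \<open>b\<close> directly; in the right one it is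
        inserted by replacing \<open>w\<close> with \<open>sm (star b) w\<close>. Right factors are
        treated symmetrically, through \<open>z\<close>.\<close>
      show "b * a \<in> J" for b
      proof -
        have "ip z w * (b * u) = D z w * (b * a)" for z w
          using u(2)[of z "sm (star b) w"] by (simp add: ip_sm_right form_sm_right star_star mult.assoc)
        then show ?thesis
          unfolding J_def using u(1) by (auto intro!: exI[of _ "b * u"] simp: mult.assoc)
      qed
      show "a * b \<in> J" for b
      proof -
        have "u * b * ip z w = a * b * D z w" for z w
          using u(1)[of "sm b z" w] by (simp add: ip_sm_left form_sm_left mult.assoc)
        then show ?thesis
          unfolding J_def using u(2)
          by (auto intro!: exI[of _ "u * b"] simp flip: mult.assoc)
      qed
    qed
  qed
  then have "1 \<in> J" using full by (auto simp: full_module_def)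
  then obtain u where u: "u * ip z w = D z w" for z w
    by (auto simp: J_def)
  have "central u"
    unfolding central_def
  proof
    fix b
    have "(u * b - b * u) * ip z w = 0" for z w
      using u[of "sm b z" w] u[of z w]
      by (simp add: ip_sm_left form_sm_left left_diff_distrib mult.assoc)
    then have "u * b - b * u = 0" using full_annihilator_zero[OF full] by blast
    then show "u * b = b * u" by simp
  qed
  then show ?thesis using that u by metis
qed

text \<open>Fullness first makes \<open>u\<close> selfadjoint. Its negative part \<open>b\<close>
  commutes with everything, so \<open>b * D x x\<close> is positive; but it equals minus the inner
  square of \<open>sm b x\<close>. Thus \<open>b\<close> annihilates the module, and fullness gives
  \<open>b = 0\<close>.\<close>

lemma form_positive_central_multiple:
  assumes full: "full_module ip" and pos: "\<And>x. cstar_positive (D x x)"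
  obtains u where "central u" "cstar_positive u" "\<And>x y. D x y = u * ip x y"
proof -
  obtain u where u: "central u" "\<And>x y. D x y = u * ip x y"
    using form_eq_central_multiple[OF full] by blast
  have "(star u - u) * ip x y = 0" for x y
  proof -
    have "star u * ip x y = star (ip y x * u)" by (simp add: star_mult ip_star)
    also have "ip y x * u = D y x" using u by (simp add: central_def)
    also have "star (D y x) = u * ip x y" unfolding form_star by (rule u(2))
    finally show ?thesis by (simp add: left_diff_distrib)
  qed
  then have us: "star u = u" using full_annihilator_zero[OF full, of "star u - u"] by simp
  obtain a b where ab: "selfadjoint_square a" "selfadjoint_square b" "u = a - b"
      "a * b = 0" "b * a = 0" "\<And>c. c * u = u * c \<Longrightarrow> c * b = b * c"
    using selfadjoint_parts[OF us] by metis
  have bs: "star b = b" using ab(2) by (rule selfadjoint_square_star)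
  have bc: "c * b = b * c" for c using ab(6) u(1) by (simp add: central_def)
  have "sm b x = 0" for x
  proof -
    have "b * D x x = (b * (a - b)) * ip x x" by (simp add: u(2) ab(3) mult.assoc)
    also have "\<dots> = - (b * b * ip x x)" by (simp add: ab(5) right_diff_distrib)
    also have "\<dots> = - (b * ip x x * b)" by (simp only: bc[of "ip x x"] mult.assoc)
    also have "\<dots> = - ip (sm b x) (sm b x)" by (simp add: ip_sm_left ip_sm_right bs)
    finally have "b * D x x = - ip (sm b x) (sm b x)" .
    moreover have "selfadjoint_square (b * D x x)"
      using ab(2) pos bc by (intro selfadjoint_square_mult) (simp_all add: cstar_positive_iff)
    ultimately have "ip (sm b x) (sm b x) = 0"
      using selfadjoint_square_antisym selfadjoint_square_ip by metis
    then show ?thesis by (rule ip_definite)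
  qed
  then have "b * ip x y = 0" for x y by (metis ip_sm_left ip_zero_left)
  then have "b = 0" using full_annihilator_zero[OF full] by blast
  then have "cstar_positive u" using ab by (simp add: cstar_positive_iff)
  then show ?thesis using that u by blast
qed

end


section \<open>Orthogonal projections\<close>

context hilbert_module
begin

lemma ip_scaleR_left: "ip (r *\<^sub>R x) y = r *\<^sub>R ip x y"
  using ip_sm_left[of "r *\<^sub>R 1" x y] by (simp add: sm_scaleR)

lemma closed_orthogonal: "closed (orthogonal ip K)"
proof -
  have "bounded_linear (\<lambda>u. ip u x)" for x
    by (rule bounded_linear_intro[where K = "norm x"])
       (simp_all add: ip_add_left ip_scaleR_left cauchy_schwarz)
  then have "continuous_on UNIV (\<lambda>u. ip u x)" for x
    by (rule bounded_linear.continuous_on[OF _ continuous_on_id])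
  then have "closed {u. ip u x = 0}" for x
    by (rule closed_Collect_eq[OF _ continuous_on_const])
  then have "closed (\<Inter>x\<in>K. {u. ip u x = 0})" by blast
  moreover have "orthogonal ip K = (\<Inter>x\<in>K. {u. ip u x = 0})" by (auto simp: orthogonal_def)
  ultimately show ?thesis by simp
qed

lemma orth_proj_eq:
  assumes K: "orthogonally_complemented sm ip K" and k: "k \<in> K" "x - k \<in> orthogonal ip K"
  shows "orth_proj ip K x = k"
  unfolding orth_proj_def
proof (rule the_equality)
  fix l assume l: "l \<in> K \<and> x - l \<in> orthogonal ip K"
  have sub: "submodule sm K" using K by (simp add: orthogonally_complemented_def)
  have "- k = sm ((- 1) *\<^sub>R 1) k" using sm_scaleR[of "- 1" k] by simp
  then have "- k \<in> K" using sub k(1) by (simp add: submodule_def)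
  then have "l + - k \<in> K" using sub l unfolding submodule_def by blast
  moreover have "l + - k \<in> orthogonal ip K"
  proof -
    have "ip (l + - k) y = ip (x - k) y - ip (x - l) y" for y
      by (simp add: ip_add_left ip_minus_left ip_diff_left)
    then show ?thesis using l k(2) by (simp add: orthogonal_def)
  qed
  ultimately have "l + - k = 0" using K unfolding orthogonally_complemented_def by blast
  then show "l = k" by simp
qed (use k in simp)

lemma orth_proj_in:
  assumes K: "orthogonally_complemented sm ip K"
  shows "orth_proj ip K x \<in> K" and "x - orth_proj ip K x \<in> orthogonal ip K"
proof -
  obtain k u where "k \<in> K" "u \<in> orthogonal ip K" "x = k + u"
    using K unfolding orthogonally_complemented_def by blast
  then have k: "k \<in> K" "x - k \<in> orthogonal ip K" by simp_all
  then show "orth_proj ip K x \<in> K" "x - orth_proj ip K x \<in> orthogonal ip K"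
    using orth_proj_eq[OF K k] by simp_all
qed

end

section \<open>Transport along \<open>\<Psi>\<close>\<close>

lemma image_orthogonally_complemented:
  assumes E: "hilbert_module smE ipE" and F: "hilbert_module smF ipF"
    and bij: "bij \<Psi>" and lin: "module_linear smE smF \<Psi>"
    and orth: "orthogonality_preserving ipE ipF \<Psi>"
    and V: "orthogonally_complemented smE ipE V"
  shows "orthogonally_complemented smF ipF (\<Psi> ` V)"
    and "orth_proj ipF (\<Psi> ` V) (\<Psi> x) = \<Psi> (orth_proj ipE V x)"
proof -
  interpret E: hilbert_module smE ipE by fact
  interpret F: hilbert_module smF ipF by fact
  have add: "\<Psi> (x + y) = \<Psi> x + \<Psi> y" and sm: "\<Psi> (smE a x) = smF a (\<Psi> x)" for x y a
    using lin by (simp_all add: module_linear_def)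
  have zero: "\<Psi> 0 = 0" using add[of 0 0] by simp
  have diff: "\<Psi> (x - y) = \<Psi> x - \<Psi> y" for x y using add[of "x - y" y] by simp
  define W where "W = orthogonal ipE V"
  have split: "\<exists>k\<in>V. \<exists>u\<in>W. x = k + u" for x
    using V by (auto simp: orthogonally_complemented_def W_def)
  have perp: "ipF (\<Psi> u) (\<Psi> k) = 0" if "u \<in> W" "k \<in> V" for u k
    using that orth by (auto simp: W_def orthogonal_def orthogonality_preserving_def)
  have perp': "ipF (\<Psi> k) (\<Psi> u) = 0" if "u \<in> W" "k \<in> V" for u k
    using perp[OF that] by (metis F.ip_star star_zero)
  have sub: "submodule smF (\<Psi> ` V)"
  proof -
    have "submodule smE V" using V by (simp add: orthogonally_complemented_def)
    then have V': "0 \<in> V" "\<And>x y. x \<in> V \<Longrightarrow> y \<in> V \<Longrightarrow> x + y \<in> V" "\<And>a x. x \<in> V \<Longrightarrow> smE a x \<in> V"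
      by (auto simp: submodule_def)
    show ?thesis
      unfolding submodule_def
    proof (intro conjI ballI allI)
      show "0 \<in> \<Psi> ` V" using V'(1) zero by (metis imageI)
      show "y + z \<in> \<Psi> ` V" if "y \<in> \<Psi> ` V" "z \<in> \<Psi> ` V" for y z
        using that V'(2) add[symmetric] by auto
      show "smF a y \<in> \<Psi> ` V" if "y \<in> \<Psi> ` V" for a y
        using that V'(3) sm[symmetric] by auto
    qed
  qed
  have "\<Psi> ` V = orthogonal ipF (\<Psi> ` W)"
  proof
    show "\<Psi> ` V \<subseteq> orthogonal ipF (\<Psi> ` W)" using perp' by (auto simp: orthogonal_def)
    show "orthogonal ipF (\<Psi> ` W) \<subseteq> \<Psi> ` V"
    proof
      fix y assume y: "y \<in> orthogonal ipF (\<Psi> ` W)"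
      obtain x where x: "y = \<Psi> x" using bij by (metis bij_pointE)
      obtain k u where ku: "k \<in> V" "u \<in> W" "x = k + u" using split by blast
      \<comment> \<open>Both \<open>y\<close> and \<open>\<Psi> k\<close> are orthogonal to
        \<open>\<Psi> u\<close>, so their difference \<open>\<Psi> u\<close> is orthogonal to
        itself.\<close>
      have "ipF (\<Psi> u) (\<Psi> u) = ipF y (\<Psi> u) - ipF (\<Psi> k) (\<Psi> u)"
        by (simp add: x ku(3) add F.ip_add_left)
      also have "\<dots> = 0" using y ku perp' by (simp add: orthogonal_def)
      finally have "\<Psi> u = 0" by (rule F.ip_definite)
      then show "y \<in> \<Psi> ` V" using ku by (simp add: x add)
    qed
  qed
  then have "closed (\<Psi> ` V)" using F.closed_orthogonal by metis
  moreover have "\<exists>k\<in>\<Psi> ` V. \<exists>u\<in>orthogonal ipF (\<Psi> ` V). y = k + u" for y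
  proof -
    obtain x where x: "y = \<Psi> x" using bij by (metis bij_pointE)
    obtain k u where ku: "k \<in> V" "u \<in> W" "x = k + u" using split by blast
    have "\<Psi> u \<in> orthogonal ipF (\<Psi> ` V)" using ku(2) perp by (auto simp: orthogonal_def)
    then show ?thesis using ku by (auto simp: x add)
  qed
  moreover have "\<Psi> ` V \<inter> orthogonal ipF (\<Psi> ` V) = {0}"
    using sub F.ip_definite by (auto simp: orthogonal_def submodule_def)
  ultimately show oc: "orthogonally_complemented smF ipF (\<Psi> ` V)"
    using sub by (simp add: orthogonally_complemented_def)
  have "x - orth_proj ipE V x \<in> W" using E.orth_proj_in(2)[OF V] by (simp add: W_def)
  then have "\<Psi> x - \<Psi> (orth_proj ipE V x) \<in> orthogonal ipF (\<Psi> ` V)"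
    using perp by (auto simp: orthogonal_def simp flip: diff)
  then show "orth_proj ipF (\<Psi> ` V) (\<Psi> x) = \<Psi> (orth_proj ipE V x)"
    using E.orth_proj_in(1)[OF V] by (intro F.orth_proj_eq[OF oc]) auto
qed

lemma cstar_le_mult_left_central:
  assumes "central u" "cstar_positive u" "a \<preceq> b"
  shows "u * a \<preceq> u * b"
proof -
  have "selfadjoint_square (u * (b - a))"
    using assms by (intro selfadjoint_square_mult) (simp_all add: cstar_le_def cstar_positive_iff central_def)
  then show ?thesis by (simp add: cstar_le_def cstar_positive_iff right_diff_distrib)
qed

theorem theorem3p7:
  fixes smE :: "'a::cstar_algebra_1 \<Rightarrow> 'e::banach \<Rightarrow> 'e"
    and ipE :: "'e \<Rightarrow> 'e \<Rightarrow> 'a"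
    and smF :: "'a \<Rightarrow> 'f::banach \<Rightarrow> 'f"
    and ipF :: "'f \<Rightarrow> 'f \<Rightarrow> 'a"
    and \<Psi> :: "'e \<Rightarrow> 'f"
    and V :: "nat \<Rightarrow> 'e set"
    and \<omega> :: "nat \<Rightarrow> 'a"
    and A B :: 'a
  assumes "hilbert_module smE ipE"
    and "hilbert_module smF ipF"
    and "full_module ipE"
    and "bij \<Psi>"
    and "module_linear smE smF \<Psi>"
    and "orthogonality_preserving ipE ipF \<Psi>"
    and "star_fusion_frame_bounds smE ipE V \<omega> A B"
  shows "(\<forall>n\<ge>1. orthogonally_complemented smF ipF (\<Psi> ` V n) \<and>
                orth_proj ipF (\<Psi> ` V n) = \<Psi> \<circ> orth_proj ipE (V n) \<circ> inv \<Psi>) \<and>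
         star_fusion_frame smF ipF (\<lambda>n. \<Psi> ` V n) \<omega>"
proof -
  interpret E: hilbert_module smE ipE by fact
  interpret F: hilbert_module smF ipF by fact
  have add: "\<Psi> (x + y) = \<Psi> x + \<Psi> y" and sm: "\<Psi> (smE a x) = smF a (\<Psi> x)" for x y a
    using assms(5) by (simp_all add: module_linear_def)
  interpret D: orthogonality_form smE ipE "\<lambda>x y. ipF (\<Psi> x) (\<Psi> y)"
    using assms(6)
    by unfold_locales
      (simp_all add: add sm F.ip_add_left F.ip_sm_left F.ip_star orthogonality_preserving_def)
  obtain u where u: "central u" "cstar_positive u"
    and ipF: "\<And>x y. ipF (\<Psi> x) (\<Psi> y) = u * ipE x y"
    using D.form_positive_central_multiple[OF assms(3)] F.ip_positive by blast
  have inv: "\<Psi> (inv \<Psi> y) = y" for y using assms(4) by (simp add: bij_is_surj surj_f_inv_f)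
  have frame: "orthogonally_complemented smE ipE (V n)" if "n \<ge> 1" for n
    using assms(7) that by (simp add: star_fusion_frame_bounds_def)
  have compl: "orthogonally_complemented smF ipF (\<Psi> ` V n)"
    and proj: "orth_proj ipF (\<Psi> ` V n) y = \<Psi> (orth_proj ipE (V n) (inv \<Psi> y))" if "n \<ge> 1" for n y
    using image_orthogonally_complemented[OF assms(1,2,4-6) frame[OF that]] inv by metis+
  note abs = module_abs_square[OF assms(1)] module_abs_square[OF assms(2)]
  \<comment> \<open>The index \<open>Suc n\<close> matters: \<open>proj\<close> holds for positive
    indices only.\<close>
  have image_term: "frame_term ipF (\<lambda>n. \<Psi> ` V n) \<omega> y (Suc n) = u * frame_term ipE V \<omega> (inv \<Psi> y) (Suc n)"
    for y n
  proof -
    have "(\<omega> (Suc n))\<^sup>2 * u = u * (\<omega> (Suc n))\<^sup>2" using u(1) by (simp add: central_def)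
    then show ?thesis by (simp add: frame_term_def abs proj ipF flip: mult.assoc)
  qed
  have bound: "(module_abs ipF (smF C y))\<^sup>2 = u * (module_abs ipE (smE C (inv \<Psi> y)))\<^sup>2" for C y
    using ipF[of "smE C (inv \<Psi> y)" "smE C (inv \<Psi> y)"] by (simp add: abs sm inv)
  have "star_fusion_frame_bounds smF ipF (\<lambda>n. \<Psi> ` V n) \<omega> A B"
    using assms(7) compl u
    by (simp add: star_fusion_frame_bounds_def image_term bound summable_mult suminf_mult
        cstar_le_mult_left_central)
  then show ?thesis
    using compl proj by (auto simp: star_fusion_frame_def fun_eq_iff)
qed

end
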